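(* Let $n,m,r,\lambda$ be positive integers with $m>5$ and $n\ge 6.285214\,m$. Any partial $r$-factorization of $\lambda K_m^5$ (with respect to $n$) can be extended to a connected $r$-factorization of $\lambda K_n^5$ if and only if $(n,r,\lambda)$ is $5$-admissible and no component of any color class of $\lambda K_m^5$ is $r$-regular.
   Context: $\lambda K_n^h$: $n$ vertices, every $h$-subset an edge of multiplicity $\lambda$; $\lambda K_m^h$ is its sub-hypergraph induced on a fixed set of $m$ vertices. Degree counts edges containing a vertex. An $r$-factor is a spanning sub-hypergraph in which every vertex has degree $r$. With $k=\lambda\binom{n-1}{h-1}/r$, a partial $r$-factorization of $\lambda K_m^h$ is a coloring of its edges with colors from $[k]$ such that each vertex has degree at most $r$ in every color class (color classes are spanning sub-hypergraphs on all $m$ vertices; components include isolated vertices). It extends to a connected $r$-factorization of $\lambda K_n^h$ if some coloring of all edges of $\lambda K_n^h$ with colors from $[k]$ agrees with it on $\lambda K_m^h$ and every color class is a connected $r$-factor. $(n,r,\lambda)$ is $h$-admissible if $h\mid rn$ and $r\mid\lambda\binom{n-1}{h-1}$. *)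

theory Defs
  imports Complex_Main
begin

text \<open>
  Multi-hypergraphs: an edge is a pair \<open>(S, j)\<close> of its vertex set \<open>S\<close> and a label \<open>j\<close> that
  tells parallel edges apart.
\<close>

datatype 'a mhypergraph = MHypergraph (verts: "'a set") (edges: "('a set \<times> nat) set")

definition complete_hypergraph :: "nat \<Rightarrow> nat \<Rightarrow> 'a set \<Rightarrow> 'a mhypergraph" where
  "complete_hypergraph lam h V =
     MHypergraph V {(S, j). S \<subseteq> V \<and> card S = h \<and> j < lam}"

definition induced_hypergraph :: "'a mhypergraph \<Rightarrow> 'a set \<Rightarrow> 'a mhypergraph" where
  "induced_hypergraph H W = MHypergraph W {e \<in> edges H. fst e \<subseteq> W}"

definition degree :: "'a mhypergraph \<Rightarrow> 'a \<Rightarrow> nat" where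
  "degree H v = card {e \<in> edges H. v \<in> fst e}"

definition regular :: "nat \<Rightarrow> 'a mhypergraph \<Rightarrow> bool" where
  "regular r H \<longleftrightarrow> (\<forall>v \<in> verts H. degree H v = r)"

definition spanning_subhypergraph :: "'a mhypergraph \<Rightarrow> 'a mhypergraph \<Rightarrow> bool" where
  "spanning_subhypergraph F H \<longleftrightarrow> verts F = verts H \<and> edges F \<subseteq> edges H"

definition is_factor :: "nat \<Rightarrow> 'a mhypergraph \<Rightarrow> 'a mhypergraph \<Rightarrow> bool" where
  "is_factor r F H \<longleftrightarrow> spanning_subhypergraph F H \<and> regular r F"

definition linked :: "'a mhypergraph \<Rightarrow> ('a \<times> 'a) set" where
  "linked H = {(u, v). u \<in> verts H \<and> v \<in> verts H \<and>
     (u, v) \<in> {(x, y). \<exists>e \<in> edges H. x \<in> fst e \<and> y \<in> fst e}\<^sup>*}"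

definition connected_hypergraph :: "'a mhypergraph \<Rightarrow> bool" where
  "connected_hypergraph H \<longleftrightarrow> (\<forall>u \<in> verts H. \<forall>v \<in> verts H. (u, v) \<in> linked H)"

text \<open>An isolated vertex forms a component of its own, because \<open>linked\<close> is reflexive.\<close>

definition components :: "'a mhypergraph \<Rightarrow> 'a mhypergraph set" where
  "components H = induced_hypergraph H ` (verts H // linked H)"

text \<open>
  The colour set \<open>[k]\<close> with \<open>k = lam * (n - 1 choose (h - 1)) / r\<close>. If \<open>k\<close> is not an integer,
  this is \<open>{1..floor k}\<close>, the set of positive integers not exceeding \<open>k\<close>.
\<close>

definition colors :: "nat \<Rightarrow> nat \<Rightarrow> nat \<Rightarrow> nat \<Rightarrow> nat set" where
  "colors h n r lam = {1 .. (lam * ((n - 1) choose (h - 1))) div r}"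

definition edge_coloring :: "'a mhypergraph \<Rightarrow> nat set \<Rightarrow> ('a set \<times> nat \<Rightarrow> nat) \<Rightarrow> bool" where
  "edge_coloring H K c \<longleftrightarrow> (\<forall>e \<in> edges H. c e \<in> K)"

definition color_class :: "'a mhypergraph \<Rightarrow> ('a set \<times> nat \<Rightarrow> nat) \<Rightarrow> nat \<Rightarrow> 'a mhypergraph" where
  "color_class H c i = MHypergraph (verts H) {e \<in> edges H. c e = i}"

definition partial_factorization ::
  "nat \<Rightarrow> nat set \<Rightarrow> 'a mhypergraph \<Rightarrow> ('a set \<times> nat \<Rightarrow> nat) \<Rightarrow> bool" where
  "partial_factorization r K H c \<longleftrightarrow>
     edge_coloring H K c \<and> (\<forall>i \<in> K. \<forall>v \<in> verts H. degree (color_class H c i) v \<le> r)"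

definition connected_factorization ::
  "nat \<Rightarrow> nat set \<Rightarrow> 'a mhypergraph \<Rightarrow> ('a set \<times> nat \<Rightarrow> nat) \<Rightarrow> bool" where
  "connected_factorization r K H c \<longleftrightarrow>
     edge_coloring H K c \<and>
     (\<forall>i \<in> K. is_factor r (color_class H c i) H \<and> connected_hypergraph (color_class H c i))"

definition admissible :: "nat \<Rightarrow> nat \<Rightarrow> nat \<Rightarrow> nat \<Rightarrow> bool" where
  "admissible h n r lam \<longleftrightarrow> h dvd r * n \<and> r dvd lam * ((n - 1) choose (h - 1))"

end

theory Submission
  imports Defs "HOL-Library.Disjoint_Sets"
begin

text \<open>
  Merge the \<open>N = n - m\<close> new vertices into one point. An edge is then a subset \<open>S\<close> of \<open>W\<close> with
  at most 5 elements, of multiplicity \<open>lam * (N choose (5 - card S))\<close>, whose \<open>5 - card S\<close>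
  missing ends (hinges) lie at the merged point.

  Edges with four, three and two vertices in \<open>W\<close> are coloured greedily without exceeding degree
  \<open>r\<close>; for two vertices this works because \<open>(n - 1 choose 4) \<le> 2 * (N choose 4)\<close>, which is
  where the constant \<open>6.285214\<close>, a bound for \<open>1 / (1 - 2 powr (-1/4))\<close>, comes from. Edges with
  a single vertex in \<open>W\<close> then raise all degrees to \<open>r\<close>, and edges without vertices in \<open>W\<close> bring
  each class to \<open>r * n / 5\<close> edges. A component of a class without hinges would be an \<open>r\<close>-regular
  component of the given class, so every component is attached to the merged point.

  The new vertices are split off one at a time as in the proof of Baranyai's theorem: a fraction
  \<open>(5 - card S) / N\<close> of the copies of \<open>S\<close> in every class receives the new vertex, rounded to
  integers by a circulation argument. The same rounding controls how many ends of each component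
  are chosen. Connectivity survives because two invariants do: every component has a hinge, and a
  class has at most \<open>(r - 1) * N + 1\<close> components and edges without vertices, the bound forced by
  a tree.
\<close>

section \<open>Rounding circulations\<close>

text \<open>Gaussian elimination: a pivot in row \<open>j\<close> removes one equation and one
  unknown, a zero row removes an equation only, so the unknowns stay in excess.\<close>

lemma homogeneous_system_nontrivial_solution:
  fixes a :: "'j \<Rightarrow> 'i \<Rightarrow> 'b::field"
  assumes "finite J" "finite I" "card J < card I"
  shows "\<exists>d. (\<exists>i\<in>I. d i \<noteq> 0) \<and> (\<forall>j\<in>J. (\<Sum>i\<in>I. a j i * d i) = 0)"
  using assms
proof (induction J arbitrary: I a rule: finite_induct)
  case empty
  then have "I \<noteq> {}" by auto
  then show ?case by (intro exI[of _ "\<lambda>_. 1"]) auto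
next
  case (insert j J)
  show ?case
  proof (cases "\<forall>i\<in>I. a j i = 0")
    case True
    have "card J < card I" using insert by simp
    then obtain d where "\<exists>i\<in>I. d i \<noteq> 0" "\<forall>j\<in>J. (\<Sum>i\<in>I. a j i * d i) = 0"
      using insert.IH[of I a] insert.prems by auto
    then show ?thesis using True by (intro exI[of _ d]) auto
  next
    case False
    then obtain p where p: "p \<in> I" "a j p \<noteq> 0" by auto
    define I' where "I' = I - {p}"
    have I': "finite I'" "p \<notin> I'" "I = insert p I'" using p insert.prems by (auto simp: I'_def)
    have "card J < card I'" using insert.prems insert.hyps p by (simp add: I'_def)
    then obtain d where d: "\<exists>i\<in>I'. d i \<noteq> 0"
      "\<forall>j'\<in>J. (\<Sum>i\<in>I'. (a j' i - a j' p * a j i / a j p) * d i) = 0"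
      using insert.IH[of I' "\<lambda>j' i. a j' i - a j' p * a j i / a j p"] I' by auto
    define d' where "d' = d(p := - (\<Sum>i\<in>I'. a j i * d i) / a j p)"
    have same: "(\<Sum>i\<in>I'. b i * d' i) = (\<Sum>i\<in>I'. b i * d i)" for b :: "'i \<Rightarrow> 'b"
      using I' by (intro sum.cong) (auto simp: d'_def)
    have "(\<Sum>i\<in>I. a j' i * d' i) = 0" if "j' \<in> insert j J" for j'
    proof (cases "j' = j")
      case True
      then show ?thesis using I' p by (simp add: same) (simp add: d'_def)
    next
      case False
      then have "0 = (\<Sum>i\<in>I'. (a j' i - a j' p * a j i / a j p) * d i)" using d that by auto
      also have "\<dots> = (\<Sum>i\<in>I'. a j' i * d i) - (a j' p / a j p) * (\<Sum>i\<in>I'. a j i * d i)"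
        by (simp add: algebra_simps sum_subtractf sum_distrib_left)
      also have "\<dots> = (\<Sum>i\<in>I. a j' i * d' i)"
        using I' by (simp add: same) (simp add: d'_def)
      finally show ?thesis by simp
    qed
    moreover have "\<exists>i\<in>I. d' i \<noteq> 0" using d(1) I' by (auto simp: d'_def)
    ultimately show ?thesis by blast
  qed
qed

text \<open>Arcs run from \<open>s\<close> to \<open>t\<close>, so the sum of
  \<open>incidence s t v e * f e\<close> over the arcs is the net outflow at \<open>v\<close>; for a
  loop the two terms cancel.\<close>

definition incidence :: "('e \<Rightarrow> 'v) \<Rightarrow> ('e \<Rightarrow> 'v) \<Rightarrow> 'v \<Rightarrow> 'e \<Rightarrow> real" where
  "incidence s t v e = of_bool (s e = v) - of_bool (t e = v)"

lemma incidence_Ints [simp]: "incidence s t v e \<in> \<int>"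
  by (auto simp: incidence_def)

text \<open>
  By conservation, no vertex meets exactly one arc of fractional value. Hence there are at least as
  many fractional arcs as vertices on them, and the conservation laws at these vertices are
  dependent, so they have a nonzero solution supported on the fractional arcs.
\<close>

lemma circulation_rounding_step:
  fixes s t :: "'e \<Rightarrow> 'v" and f :: "'e \<Rightarrow> real"
  assumes fin: "finite E" and cons: "\<And>v. (\<Sum>e\<in>E. incidence s t v e * f e) = 0"
    and F: "F = {e \<in> E. f e \<notin> \<int>}" "F \<noteq> {}"
  shows "\<exists>d. (\<exists>e\<in>F. d e \<noteq> 0) \<and> (\<forall>v. (\<Sum>e\<in>F. incidence s t v e * d e) = 0)"
proof -
  define U where "U = s ` F \<union> t ` F"
  have finF: "finite F" using fin F by auto
  have finU: "finite U" using finF by (simp add: U_def)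
  have deg: "2 \<le> card {e\<in>F. s e = v} + card {e\<in>F. t e = v}" if "v \<in> U" for v
  proof (rule ccontr)
    assume "\<not> ?thesis"
    moreover have "card {e\<in>F. s e = v} + card {e\<in>F. t e = v} \<noteq> 0"
      using that finF by (auto simp: U_def)
    ultimately have one: "card {e\<in>F. s e = v} + card {e\<in>F. t e = v} = 1" by linarith
    have "\<exists>e0\<in>F. {e\<in>F. s e = v} \<union> {e\<in>F. t e = v} = {e0} \<and> (s e0 = v) \<noteq> (t e0 = v)"
    proof (cases "card {e\<in>F. s e = v} = 1")
      case True
      then obtain e0 where e0: "{e\<in>F. s e = v} = {e0}" by (auto simp: card_1_singleton_iff)
      moreover have "{e\<in>F. t e = v} = {}" using one True finF by auto
      ultimately show ?thesis by (intro bexI[of _ e0]) auto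
    next
      case False
      then have "card {e\<in>F. t e = v} = 1" and z: "card {e\<in>F. s e = v} = 0" using one by auto
      then obtain e0 where e0: "{e\<in>F. t e = v} = {e0}" by (auto simp: card_1_singleton_iff)
      moreover have "{e\<in>F. s e = v} = {}" using z finF by auto
      ultimately show ?thesis by (intro bexI[of _ e0]) auto
    qed
    then obtain e0 where e0: "e0 \<in> F" "{e\<in>F. s e = v} \<union> {e\<in>F. t e = v} = {e0}"
      "(s e0 = v) \<noteq> (t e0 = v)" by auto
    have "0 = (\<Sum>e\<in>E. incidence s t v e * f e)" using cons by simp
    also have "\<dots> = incidence s t v e0 * f e0 + (\<Sum>e\<in>E - {e0}. incidence s t v e * f e)"
      using fin e0 F by (intro sum.remove) auto
    finally have eq: "incidence s t v e0 * f e0 = - (\<Sum>e\<in>E - {e0}. incidence s t v e * f e)" by simp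
    have "incidence s t v e * f e \<in> \<int>" if "e \<in> E - {e0}" for e
    proof (cases "e \<in> F")
      case True
      then have "s e \<noteq> v" "t e \<noteq> v" using e0(2) that by auto
      then show ?thesis by (simp add: incidence_def)
    next
      case False
      then have "f e \<in> \<int>" using that F by auto
      then show ?thesis by auto
    qed
    then have "incidence s t v e0 * f e0 \<in> \<int>" unfolding eq by (auto intro!: Ints_sum)
    then have "f e0 \<in> \<int>" using e0(3) by (auto simp: incidence_def)
    then show False using e0(1) F by auto
  qed
  have "2 * card U = (\<Sum>v\<in>U. 2)" by simp
  also have "\<dots> \<le> (\<Sum>v\<in>U. card {e\<in>F. s e = v} + card {e\<in>F. t e = v})"
    by (rule sum_mono) (rule deg)
  also have "\<dots> = card F + card F"
  proof -
    have "(\<Sum>v\<in>U. card {e\<in>F. p e = v}) = card F" if "p ` F \<subseteq> U" for p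
      using sum.group[OF finF finU that, of "\<lambda>_. 1::nat"] by simp
    from this[of s] this[of t] show ?thesis by (simp add: sum.distrib U_def)
  qed
  finally have "card U \<le> card F" by simp
  \<comment> \<open>The law at \<open>v0\<close> is left out to have fewer equations than unknowns.
    It is recovered below, because the incidences of each arc add up to 0 over
    \<open>U\<close>.\<close>
  obtain v0 where v0: "v0 \<in> U" using F(2) by (auto simp: U_def)
  have "card (U - {v0}) < card F"
    using v0 finU \<open>card U \<le> card F\<close> by (metis card_Diff1_less order_less_le_trans)
  then obtain d where d: "\<exists>e\<in>F. d e \<noteq> 0" "\<forall>v\<in>U - {v0}. (\<Sum>e\<in>F. incidence s t v e * d e) = 0"
    using homogeneous_system_nontrivial_solution[of "U - {v0}" F "incidence s t"] finF finU by auto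
  have "(\<Sum>e\<in>F. incidence s t v e * d e) = 0" for v
  proof (cases "v \<in> U")
    case False
    then show ?thesis by (intro sum.neutral) (auto simp: incidence_def U_def)
  next
    case True
    have tot: "(\<Sum>v\<in>U. incidence s t v e) = 0" if "e \<in> F" for e
      using that finU by (auto simp: incidence_def sum_subtractf U_def of_bool_def)
    have "0 = (\<Sum>e\<in>F. (\<Sum>v\<in>U. incidence s t v e) * d e)" using tot by simp
    also have "\<dots> = (\<Sum>v\<in>U. \<Sum>e\<in>F. incidence s t v e * d e)"
      by (simp add: sum_distrib_right sum.swap[of _ U])
    also have "\<dots> = (\<Sum>e\<in>F. incidence s t v0 e * d e)"
      using v0 finU d(2) by (subst sum.remove[of _ v0]) auto
    finally show ?thesis using True d(2) by (cases "v = v0") auto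
  qed
  then show ?thesis using d(1) by blast
qed

text \<open>Induction on the number of fractional arcs: adding a multiple of a circulation supported
  on them keeps the conservation laws, and the multiple is increased until the first of these arcs
  becomes integral. Integral arcs are never moved again.\<close>

lemma circulation_rounding:
  fixes s t :: "'e \<Rightarrow> 'v" and f :: "'e \<Rightarrow> real"
  assumes fin: "finite E" and cons: "\<And>v. (\<Sum>e\<in>E. incidence s t v e * f e) = 0"
  shows "\<exists>g::'e \<Rightarrow> int. (\<forall>e\<in>E. \<lfloor>f e\<rfloor> \<le> g e \<and> g e \<le> \<lceil>f e\<rceil>) \<and>
           (\<forall>v. (\<Sum>e\<in>E. incidence s t v e * of_int (g e)) = 0)"
  using cons
proof (induction "card {e \<in> E. f e \<notin> \<int>}" arbitrary: f rule: less_induct)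
  case less
  define F where "F = {e \<in> E. f e \<notin> \<int>}"
  have finF: "finite F" "F \<subseteq> E" using fin by (auto simp: F_def)
  show ?case
  proof (cases "F = {}")
    case True
    then have int: "of_int \<lfloor>f e\<rfloor> = f e" if "e \<in> E" for e
      using that by (auto simp: F_def elim!: Ints_cases)
    have "(\<Sum>e\<in>E. incidence s t v e * of_int \<lfloor>f e\<rfloor>) = 0" for v
      unfolding less.prems[of v, symmetric] by (intro sum.cong) (simp_all add: int)
    then show ?thesis by (intro exI[of _ "\<lambda>e. \<lfloor>f e\<rfloor>"]) (auto intro: order_trans[OF floor_le_ceiling])
  next
    case False
    obtain d where d: "\<exists>e\<in>F. d e \<noteq> 0" "\<And>v. (\<Sum>e\<in>F. incidence s t v e * d e) = 0"
      using circulation_rounding_step[OF fin less.prems F_def False] by blast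
    define F' where "F' = {e\<in>F. d e \<noteq> 0}"
    \<comment> \<open>\<open>\<tau> e\<close> is the multiple of \<open>d\<close> at which arc
      \<open>e\<close> reaches its ceiling or floor, according to the sign of \<open>d e\<close>;
      the smallest one, \<open>T\<close>, keeps all arcs within their bounds.\<close>
    define \<tau> where "\<tau> e = (if d e > 0 then (of_int \<lceil>f e\<rceil> - f e) / d e else (f e - of_int \<lfloor>f e\<rfloor>) / (- d e))" for e
    have F': "finite F'" "F' \<noteq> {}" using finF d by (auto simp: F'_def)
    have \<tau>pos: "\<tau> e > 0" if "e \<in> F'" for e
    proof -
      have "f e \<notin> \<int>" using that by (auto simp: F'_def F_def)
      then have "of_int \<lfloor>f e\<rfloor> < f e" "f e < of_int \<lceil>f e\<rceil>"
        by (metis Ints_of_int of_int_floor_le order_le_less, metis Ints_of_int le_of_int_ceiling order_le_less)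
      then show ?thesis using that by (auto simp: \<tau>_def F'_def divide_simps)
    qed
    define T where "T = Min (\<tau> ` F')"
    have "T \<in> \<tau> ` F'" unfolding T_def using F' by (intro Min_in) auto
    then obtain e0 where e0: "e0 \<in> F'" "T = \<tau> e0" by auto
    have Tpos: "T > 0" using e0 \<tau>pos by auto
    have Tle: "T \<le> \<tau> e" if "e \<in> F'" for e using that F' by (simp add: T_def)
    define f' where "f' e = (if e \<in> F then f e + T * d e else f e)" for e
    have bounds: "of_int \<lfloor>f e\<rfloor> \<le> f' e \<and> f' e \<le> of_int \<lceil>f e\<rceil>" if "e \<in> E" for e
    proof (cases "e \<in> F'")
      case False
      then have "f' e = f e" by (auto simp: f'_def F'_def)
      then show ?thesis by simp
    next
      case True
      then have eF: "e \<in> F" and "d e \<noteq> 0" by (auto simp: F'_def)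
      show ?thesis
      proof (cases "d e > 0")
        case True
        then have "T * d e \<le> of_int \<lceil>f e\<rceil> - f e"
          using Tle[OF \<open>e \<in> F'\<close>] by (simp add: \<tau>_def pos_le_divide_eq)
        moreover have "T * d e \<ge> 0" using Tpos True by simp
        moreover have "f' e = f e + T * d e" using eF by (simp add: f'_def)
        ultimately show ?thesis using of_int_floor_le[of "f e"] by linarith
      next
        case False
        then have dn: "- d e > 0" using \<open>d e \<noteq> 0\<close> by simp
        then have "T * (- d e) \<le> f e - of_int \<lfloor>f e\<rfloor>"
          using Tle[OF \<open>e \<in> F'\<close>] False by (simp only: \<tau>_def if_False pos_le_divide_eq)
        moreover have "T * (- d e) \<ge> 0" using Tpos dn by (intro mult_nonneg_nonneg) auto
        moreover have "f' e = f e - T * (- d e)" using eF by (simp add: f'_def)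
        ultimately show ?thesis using le_of_int_ceiling[of "f e"] by linarith
      qed
    qed
    have "f' e0 \<in> \<int>"
    proof -
      have "e0 \<in> F" "d e0 \<noteq> 0" using e0 by (auto simp: F'_def)
      then have "f' e0 = (if d e0 > 0 then of_int \<lceil>f e0\<rceil> else of_int \<lfloor>f e0\<rfloor>)"
        using e0(2) by (simp add: f'_def \<tau>_def)
      then show ?thesis by auto
    qed
    moreover have "f' e \<in> \<int>" if "e \<in> E" "f e \<in> \<int>" for e
      using that by (simp add: f'_def F_def)
    ultimately have "{e \<in> E. f' e \<notin> \<int>} \<subset> {e \<in> E. f e \<notin> \<int>}"
      using e0 by (auto simp: F'_def F_def)
    then have lt: "card {e \<in> E. f' e \<notin> \<int>} < card {e \<in> E. f e \<notin> \<int>}"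
      using fin by (intro psubset_card_mono) auto
    have "(\<Sum>e\<in>E. incidence s t v e * f' e) = 0" for v
    proof -
      have "(\<Sum>e\<in>E. incidence s t v e * f' e) =
          (\<Sum>e\<in>E. incidence s t v e * f e) + (\<Sum>e\<in>E. if e \<in> F then T * (incidence s t v e * d e) else 0)"
        unfolding sum.distrib[symmetric] by (intro sum.cong) (auto simp: f'_def algebra_simps)
      also have "(\<Sum>e\<in>E. if e \<in> F then T * (incidence s t v e * d e) else 0) =
          (\<Sum>e\<in>F. T * (incidence s t v e * d e))"
        using fin finF by (simp add: sum.inter_restrict[symmetric] Int_absorb1)
      finally show ?thesis using less.prems d(2) by (simp add: sum_distrib_left[symmetric])
    qed
    from less.hyps[OF lt this] obtain g :: "'e \<Rightarrow> int"
      where g: "\<forall>e\<in>E. \<lfloor>f' e\<rfloor> \<le> g e \<and> g e \<le> \<lceil>f' e\<rceil>"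
        "\<forall>v. (\<Sum>e\<in>E. incidence s t v e * of_int (g e)) = 0" by blast
    have "\<lfloor>f e\<rfloor> \<le> g e \<and> g e \<le> \<lceil>f e\<rceil>" if "e \<in> E" for e
    proof -
      \<comment> \<open>As \<open>f'\<close> stays between the floor and the ceiling of
        \<open>f\<close>, rounding \<open>f'\<close> is also a rounding of \<open>f\<close>.\<close>
      have "\<lfloor>f e\<rfloor> \<le> \<lfloor>f' e\<rfloor>" "\<lceil>f' e\<rceil> \<le> \<lceil>f e\<rceil>"
        using bounds[OF that] by (simp_all add: le_floor_iff ceiling_le_iff)
      then show ?thesis using g(1) that by force
    qed
    then show ?thesis using g(2) by blast
  qed
qed

section \<open>Simultaneous rounding along nested groupings\<close>

definition rounds_to :: "real \<Rightarrow> int \<Rightarrow> bool" where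
  "rounds_to x y \<longleftrightarrow> \<lfloor>x\<rfloor> \<le> y \<and> y \<le> \<lceil>x\<rceil>"

text \<open>This is how exact counts come out of a rounding: a total that is already a whole number
  cannot move.\<close>

lemma rounds_to_of_nat [simp]: "rounds_to (of_nat z) y \<longleftrightarrow> y = int z"
  by (auto simp: rounds_to_def)

lemma rounds_to_0 [simp]: "rounds_to 0 y \<longleftrightarrow> y = 0"
  by (auto simp: rounds_to_def)

lemma sum_fibres:
  assumes "finite E"
  shows "(\<Sum>w\<in>{w \<in> f ` E. p w = u}. \<Sum>e\<in>{e\<in>E. f e = w}. x e) = (\<Sum>e\<in>{e\<in>E. p (f e) = u}. x e)"
proof -
  have "(\<Sum>w\<in>{w \<in> f ` E. p w = u}. \<Sum>e\<in>{e\<in>E. f e = w}. x e) =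
        (\<Sum>w\<in>{w \<in> f ` E. p w = u}. \<Sum>e\<in>{e\<in>{e\<in>E. p (f e) = u}. f e = w}. x e)"
    by (intro sum.cong) auto
  also have "\<dots> = (\<Sum>e\<in>{e\<in>E. p (f e) = u}. x e)"
    using assms by (intro sum.group) auto
  finally show ?thesis .
qed

text \<open>The network is a tree of groups hanging from \<open>Root\<close>, with levels
  \<open>NodeA\<close>, \<open>NodeB\<close>, \<open>NodeC\<close>. The arc named after a group
  enters its node from the level above, a cell runs from its \<open>NodeC\<close> to its
  \<open>NodeG\<close>, and the arcs \<open>ArcG\<close> lead back to \<open>Root\<close>.\<close>

datatype ('a, 'b, 'c, 'g) rnode = Root | NodeA 'a | NodeB 'b | NodeC 'c | NodeG 'g
datatype ('e, 'a, 'b, 'c, 'g) rarc = Cell 'e | ArcA 'a | ArcB 'b | ArcC 'c | ArcG 'g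

text \<open>Let each cell carry the flow \<open>x e\<close>. By conservation every group total is
  the flow on a single arc, so one rounded circulation rounds all totals together. The groupings by
  \<open>c\<close>, \<open>q\<close> and \<open>p\<close> must be nested to form the levels of a
  tree; \<open>g\<close> is independent of them and uses the other end of the cells.\<close>

theorem hierarchical_rounding:
  fixes x :: "'e \<Rightarrow> real" and c :: "'e \<Rightarrow> 'c" and q :: "'c \<Rightarrow> 'b" and p :: "'b \<Rightarrow> 'a" and g :: "'e \<Rightarrow> 'g"
  assumes fin: "finite E"
  obtains y :: "'e \<Rightarrow> int" where
    "\<And>e. e \<in> E \<Longrightarrow> rounds_to (x e) (y e)"
    "\<And>u. rounds_to (\<Sum>e\<in>{e\<in>E. g e = u}. x e) (\<Sum>e\<in>{e\<in>E. g e = u}. y e)"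
    "\<And>u. rounds_to (\<Sum>e\<in>{e\<in>E. c e = u}. x e) (\<Sum>e\<in>{e\<in>E. c e = u}. y e)"
    "\<And>u. rounds_to (\<Sum>e\<in>{e\<in>E. q (c e) = u}. x e) (\<Sum>e\<in>{e\<in>E. q (c e) = u}. y e)"
    "\<And>u. rounds_to (\<Sum>e\<in>{e\<in>E. p (q (c e)) = u}. x e) (\<Sum>e\<in>{e\<in>E. p (q (c e)) = u}. y e)"
proof -
  define C where "C = c ` E"
  define B where "B = q ` C"
  define A where "A = p ` B"
  define G where "G = g ` E"
  define arcs :: "('e, 'a, 'b, 'c, 'g) rarc set"
    where "arcs = Cell ` E \<union> (ArcA ` A \<union> (ArcB ` B \<union> (ArcC ` C \<union> ArcG ` G)))"
  have fins: "finite C" "finite B" "finite A" "finite G"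
    using fin by (simp_all add: C_def B_def A_def G_def)
  have finarcs: "finite arcs" using fins fin by (simp add: arcs_def)
  define s :: "('e, 'a, 'b, 'c, 'g) rarc \<Rightarrow> ('a, 'b, 'c, 'g) rnode" where
    "s a = (case a of Cell e \<Rightarrow> NodeC (c e) | ArcA u \<Rightarrow> Root | ArcB u \<Rightarrow> NodeA (p u)
       | ArcC u \<Rightarrow> NodeB (q u) | ArcG u \<Rightarrow> NodeG u)" for a
  define t :: "('e, 'a, 'b, 'c, 'g) rarc \<Rightarrow> ('a, 'b, 'c, 'g) rnode" where
    "t a = (case a of Cell e \<Rightarrow> NodeG (g e) | ArcA u \<Rightarrow> NodeA u | ArcB u \<Rightarrow> NodeB u
       | ArcC u \<Rightarrow> NodeC u | ArcG u \<Rightarrow> Root)" for a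
  have split: "sum \<phi> arcs = (\<Sum>e\<in>E. \<phi> (Cell e)) + ((\<Sum>u\<in>A. \<phi> (ArcA u)) + ((\<Sum>u\<in>B. \<phi> (ArcB u))
      + ((\<Sum>u\<in>C. \<phi> (ArcC u)) + (\<Sum>u\<in>G. \<phi> (ArcG u)))))" for \<phi> :: "_ \<Rightarrow> real"
    unfolding arcs_def using fin fins
    by (subst sum.union_disjoint; (subst sum.union_disjoint)?; (auto simp: sum.reindex inj_on_def)?)+
  have filt: "(\<Sum>u\<in>U. of_bool (P u) * \<phi> u) = (\<Sum>u\<in>{u\<in>U. P u}. \<phi> u)"
    if "finite U" for U P and \<phi> :: "'z \<Rightarrow> real"
    using that by (auto simp: sum.inter_filter of_bool_def if_distrib if_distribR intro!: sum.cong)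
  define S where "S \<phi> v = (\<Sum>a\<in>arcs. incidence s t v a * \<phi> a)" for \<phi> v
  have S: 
    "S \<phi> Root = (\<Sum>u\<in>A. \<phi> (ArcA u)) - (\<Sum>u\<in>G. \<phi> (ArcG u))"
    "S \<phi> (NodeA a) = (\<Sum>w\<in>{w\<in>B. p w = a}. \<phi> (ArcB w)) - (\<Sum>u\<in>{u. u = a \<and> u \<in> A}. \<phi> (ArcA u))"
    "S \<phi> (NodeB b) = (\<Sum>w\<in>{w\<in>C. q w = b}. \<phi> (ArcC w)) - (\<Sum>u\<in>{u. u = b \<and> u \<in> B}. \<phi> (ArcB u))"
    "S \<phi> (NodeC d) = (\<Sum>e\<in>{e\<in>E. c e = d}. \<phi> (Cell e)) - (\<Sum>u\<in>{u. u = d \<and> u \<in> C}. \<phi> (ArcC u))"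
    "S \<phi> (NodeG d') = (\<Sum>u\<in>{u. u = d' \<and> u \<in> G}. \<phi> (ArcG u)) - (\<Sum>e\<in>{e\<in>E. g e = d'}. \<phi> (Cell e))"
    for \<phi> a b d d'
    unfolding S_def split incidence_def s_def t_def
    using fin fins
    by (simp_all add: filt sum_negf)
      (simp_all add: Int_def conj_commute)
  have single: "(\<Sum>u\<in>{u. u = a \<and> u \<in> U}. \<phi> u) = (if a \<in> U then \<phi> a else 0)" for U a and \<phi> :: "'z \<Rightarrow> real"
  proof -
    have "{u. u = a \<and> u \<in> U} = (if a \<in> U then {a} else {})" by auto
    then show ?thesis by simp
  qed
  have sumC: "(\<Sum>w\<in>{w\<in>C. q w = b}. \<Sum>e\<in>{e\<in>E. c e = w}. z e) = (\<Sum>e\<in>{e\<in>E. q (c e) = b}. z e)"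
    for z :: "'e \<Rightarrow> real" and b
    unfolding C_def by (rule sum_fibres[OF fin])
  have sumB: "(\<Sum>w\<in>{w\<in>B. p w = a}. \<Sum>e\<in>{e\<in>E. q (c e) = w}. z e) = (\<Sum>e\<in>{e\<in>E. p (q (c e)) = a}. z e)"
    for z :: "'e \<Rightarrow> real" and a
    using sum_fibres[OF fin, where f = "\<lambda>e. q (c e)" and p = p and x = z] by (simp add: B_def C_def image_image)
  have notin: "u \<notin> A \<Longrightarrow> {e\<in>E. p (q (c e)) = u} = {}" "v \<notin> B \<Longrightarrow> {e\<in>E. q (c e) = v} = {}"
    "w \<notin> C \<Longrightarrow> {e\<in>E. c e = w} = {}" "z \<notin> G \<Longrightarrow> {e\<in>E. g e = z} = {}" for u v w z
    by (auto simp: A_def B_def C_def G_def)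
  define f where "f a = (case a of Cell e \<Rightarrow> x e | ArcA u \<Rightarrow> (\<Sum>e\<in>{e\<in>E. p (q (c e)) = u}. x e)
       | ArcB u \<Rightarrow> (\<Sum>e\<in>{e\<in>E. q (c e) = u}. x e) | ArcC u \<Rightarrow> (\<Sum>e\<in>{e\<in>E. c e = u}. x e)
       | ArcG u \<Rightarrow> (\<Sum>e\<in>{e\<in>E. g e = u}. x e))" for a
  have "S f v = 0" for v
  proof (cases v)
    case Root
    have "(\<Sum>u\<in>A. \<Sum>e\<in>{e\<in>E. p (q (c e)) = u}. x e) = sum x E"
      using fin fins by (intro sum.group) (auto simp: A_def B_def C_def)
    moreover have "(\<Sum>u\<in>G. \<Sum>e\<in>{e\<in>E. g e = u}. x e) = sum x E"
      using fin fins by (intro sum.group) (auto simp: G_def)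
    ultimately show ?thesis using Root by (simp add: S f_def)
  qed (auto simp: S single f_def sumC sumB notin)
  then obtain y :: "_ \<Rightarrow> int" where y: "\<And>a. a \<in> arcs \<Longrightarrow> \<lfloor>f a\<rfloor> \<le> y a \<and> y a \<le> \<lceil>f a\<rceil>"
    "\<And>v. S (\<lambda>a. of_int (y a)) v = 0"
    using circulation_rounding[OF finarcs, of s t f] unfolding S_def by blast
  have r: "rounds_to (f a) (y a)" if "a \<in> arcs" for a
    using y(1)[OF that] by (simp add: rounds_to_def)
  \<comment> \<open>Conservation of \<open>y\<close> at a group's node turns the value on its arc
    into the sum over its cells, first at the leaves and then up the tree.\<close>
  have yC: "of_int (y (ArcC u)) = (\<Sum>e\<in>{e\<in>E. c e = u}. real_of_int (y (Cell e)))" if "u \<in> C" for u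
    using y(2)[of "NodeC u"] that by (simp add: S single)
  have yG: "of_int (y (ArcG u)) = (\<Sum>e\<in>{e\<in>E. g e = u}. real_of_int (y (Cell e)))" if "u \<in> G" for u
    using y(2)[of "NodeG u"] that by (simp add: S single)
  have yB: "of_int (y (ArcB u)) = (\<Sum>e\<in>{e\<in>E. q (c e) = u}. real_of_int (y (Cell e)))" if "u \<in> B" for u
    using y(2)[of "NodeB u"] that by (simp add: S single yC sumC)
  have yA: "of_int (y (ArcA u)) = (\<Sum>e\<in>{e\<in>E. p (q (c e)) = u}. real_of_int (y (Cell e)))" if "u \<in> A" for u
    using y(2)[of "NodeA u"] that by (simp add: S single yB sumB)
  show ?thesis
  proof (rule that[of "\<lambda>e. y (Cell e)"])
    show "rounds_to (x e) (y (Cell e))" if "e \<in> E" for e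
      using r[of "Cell e"] that by (simp add: f_def arcs_def)
    show "rounds_to (\<Sum>e\<in>{e\<in>E. g e = u}. x e) (\<Sum>e\<in>{e\<in>E. g e = u}. y (Cell e))" for u
    proof (cases "u \<in> G")
      case True
      have "y (ArcG u) = (\<Sum>e\<in>{e\<in>E. g e = u}. y (Cell e))"
        using yG[OF True] by (simp flip: of_int_sum)
      then show ?thesis using r[of "ArcG u"] True by (simp add: f_def arcs_def)
    qed (simp add: notin)
    show "rounds_to (\<Sum>e\<in>{e\<in>E. c e = u}. x e) (\<Sum>e\<in>{e\<in>E. c e = u}. y (Cell e))" for u
    proof (cases "u \<in> C")
      case True
      have "y (ArcC u) = (\<Sum>e\<in>{e\<in>E. c e = u}. y (Cell e))"
        using yC[OF True] by (simp flip: of_int_sum)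
      then show ?thesis using r[of "ArcC u"] True by (simp add: f_def arcs_def)
    qed (simp add: notin)
    show "rounds_to (\<Sum>e\<in>{e\<in>E. q (c e) = u}. x e) (\<Sum>e\<in>{e\<in>E. q (c e) = u}. y (Cell e))" for u
    proof (cases "u \<in> B")
      case True
      have "y (ArcB u) = (\<Sum>e\<in>{e\<in>E. q (c e) = u}. y (Cell e))"
        using yB[OF True] by (simp flip: of_int_sum)
      then show ?thesis using r[of "ArcB u"] True by (simp add: f_def arcs_def)
    qed (simp add: notin)
    show "rounds_to (\<Sum>e\<in>{e\<in>E. p (q (c e)) = u}. x e) (\<Sum>e\<in>{e\<in>E. p (q (c e)) = u}. y (Cell e))" for u
    proof (cases "u \<in> A")
      case True
      have "y (ArcA u) = (\<Sum>e\<in>{e\<in>E. p (q (c e)) = u}. y (Cell e))"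
        using yA[OF True] by (simp flip: of_int_sum)
      then show ?thesis using r[of "ArcA u"] True by (simp add: f_def arcs_def)
    qed (simp add: notin)
  qed
qed

section \<open>Splitting off one vertex within a colour class\<close>

text \<open>Only vertices already split off are linked. Two vertices whose edges merely share the
  merged point are not.\<close>

definition class_link :: "('a set \<Rightarrow> nat) \<Rightarrow> ('a \<times> 'a) set" where
  "class_link A = {(x, y). \<exists>S. A S > 0 \<and> x \<in> S \<and> y \<in> S}"

lemma sym_class_link_rtrancl: "(x, y) \<in> (class_link A)\<^sup>* \<Longrightarrow> (y, x) \<in> (class_link A)\<^sup>*"
proof -
  have "sym (class_link A)" by (auto simp: class_link_def sym_def)
  then show "(x, y) \<in> (class_link A)\<^sup>* \<Longrightarrow> (y, x) \<in> (class_link A)\<^sup>*"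
    by (metis sym_rtrancl symD)
qed

text \<open>The empty set is left out because edges without vertices in \<open>X\<close> belong to
  no part, although \<open>{}\<close> is a subset of every \<open>C\<close>.\<close>

definition hinges :: "nat \<Rightarrow> ('a set \<Rightarrow> nat) \<Rightarrow> 'a set \<Rightarrow> nat" where
  "hinges h A C = (\<Sum>S\<in>Pow C - {{}}. (h - card S) * A S)"

lemma sum_Pow_insert:
  assumes "finite X" "b \<notin> X"
  shows "sum F (Pow (insert b X)) = (\<Sum>S\<in>Pow X. F S + F (insert b S))"
proof -
  have "inj_on (insert b) (Pow X)"
    using assms(2) by (auto intro!: inj_onI dest!: insert_ident[THEN iffD1, rotated 2])
  then show ?thesis
    using assms by (subst Pow_insert, subst sum.union_disjoint) (auto simp: sum.reindex sum.distrib)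
qed

text \<open>Each nonempty set that contributes lies in exactly one part; the empty set lies in all
  of them and is therefore counted apart.\<close>

lemma sum_Pow_partition:
  fixes f :: "'a set \<Rightarrow> nat"
  assumes "finite X" "partition_on X P"
    and "\<And>S. f S \<noteq> 0 \<Longrightarrow> S \<noteq> {} \<Longrightarrow> \<exists>C\<in>P. S \<subseteq> C"
  shows "sum f (Pow X) = f {} + (\<Sum>C\<in>P. \<Sum>S\<in>Pow C - {{}}. f S)"
proof -
  have finP: "finite P" using finite_elements assms by blast
  have sub: "C \<subseteq> X" if "C \<in> P" for C using that assms(2) by (auto simp: partition_on_def)
  have finC: "finite C" if "C \<in> P" for C using sub[OF that] assms(1) finite_subset by blast
  have "sum f (Pow X) = f {} + sum f (Pow X - {{}})"
    using assms(1) by (intro sum.remove) auto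
  also have "sum f (Pow X - {{}}) = sum f (\<Union>C\<in>P. Pow C - {{}})"
  proof (rule sum.mono_neutral_right)
    show "finite (Pow X - {{}})" using assms(1) by simp
    show "(\<Union>C\<in>P. Pow C - {{}}) \<subseteq> Pow X - {{}}" using sub by blast
    show "\<forall>S\<in>Pow X - {{}} - (\<Union>C\<in>P. Pow C - {{}}). f S = 0" using assms(3) by blast
  qed
  also have "\<dots> = (\<Sum>C\<in>P. \<Sum>S\<in>Pow C - {{}}. f S)"
  proof (rule sum.UNION_disjoint)
    show "\<forall>C\<in>P. \<forall>D\<in>P. C \<noteq> D \<longrightarrow> (Pow C - {{}}) \<inter> (Pow D - {{}}) = {}"
      using assms(2) unfolding partition_on_def disjoint_def by blast
  qed (use finP finC in auto)
  finally show ?thesis .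
qed

text \<open>
  One colour class when the vertices in \<open>X\<close> have been split off: \<open>A S\<close> is the number of edges
  meeting \<open>X\<close> in \<open>S\<close>, and \<open>P\<close> is a partition of \<open>X\<close> into connected parts.
\<close>

locale class_state =
  fixes h r n :: nat and X :: "'a set" and A :: "'a set \<Rightarrow> nat" and P :: "'a set set"
  assumes h2: "2 \<le> h" and r1: "1 \<le> r"
    and finX: "finite X" and card_le: "card X \<le> n"
    and support: "\<And>S. A S > 0 \<Longrightarrow> S \<subseteq> X \<and> card S \<le> h"
    and deg: "\<And>v. v \<in> X \<Longrightarrow> (\<Sum>S\<in>Pow X. if v \<in> S then A S else 0) = r"
    and total: "(\<Sum>S\<in>Pow X. (h - card S) * A S) = r * (n - card X)"
    and part: "partition_on X P"
    and refines: "\<And>S. A S > 0 \<Longrightarrow> S \<noteq> {} \<Longrightarrow> \<exists>C\<in>P. S \<subseteq> C"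
    and conn: "\<And>C x y. C \<in> P \<Longrightarrow> x \<in> C \<Longrightarrow> y \<in> C \<Longrightarrow> (x, y) \<in> (class_link A)\<^sup>*"
    and hinged: "\<And>C. card X < n \<Longrightarrow> C \<in> P \<Longrightarrow> hinges h A C > 0"
    and few_parts: "card P + A {} \<le> (r - 1) * (n - card X) + 1"
begin

text \<open>A part with one hinge is a leaf at the merged point. If the new vertex took hinges of
  leaves only, its own part would be left without a hinge; hence it needs at least one edge from
  this family.\<close>

definition nonleaf :: "'a set set" where
  "nonleaf = {S \<in> Pow X. S = {} \<or> (\<exists>C\<in>P. S \<subseteq> C \<and> hinges h A C \<ge> 2)}"

lemma finP: "finite P" using finite_elements finX part by blast

lemma part_subset: "C \<in> P \<Longrightarrow> C \<subseteq> X" using part by (auto simp: partition_on_def)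

lemma fin_part: "C \<in> P \<Longrightarrow> finite C" using part_subset finX finite_subset by blast

lemma total_parts: "r * (n - card X) = h * A {} + (\<Sum>C\<in>P. hinges h A C)"
proof -
  have "r * (n - card X) = (\<Sum>S\<in>Pow X. (h - card S) * A S)" using total by simp
  also have "\<dots> = (h - card ({}::'a set)) * A {} + (\<Sum>C\<in>P. \<Sum>S\<in>Pow C - {{}}. (h - card S) * A S)"
    by (rule sum_Pow_partition[OF finX part]) (use refines in auto)
  finally show ?thesis by (simp add: hinges_def)
qed

text \<open>Each leaf accounts for one of the \<open>r * N\<close> hinges. If fewer than
  \<open>N\<close> hinges were elsewhere, there would be at least \<open>(r - 1) * N + 1\<close>
  leaves, so by \<open>few_parts\<close> nothing but leaves; but then there are \<open>r * N\<close>
  of them, too many since \<open>N\<close> is at least 2.\<close>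

lemma nonleaf_heavy:
  assumes "n - card X \<ge> 2"
  shows "n - card X \<le> (\<Sum>S\<in>nonleaf. (h - card S) * A S)"
proof -
  define N where "N = n - card X"
  define Z where "Z = (\<Sum>S\<in>nonleaf. (h - card S) * A S)"
  define L where "L = {C\<in>P. \<not> hinges h A C \<ge> 2}"
  define Q where "Q = {C\<in>P. hinges h A C \<ge> 2}"
  have PLQ: "P = L \<union> Q" "L \<inter> Q = {}" by (auto simp: L_def Q_def)
  have fin: "finite L" "finite Q" using finP by (auto simp: L_def Q_def)
  have L1: "hinges h A C = 1" if "C \<in> L" for C
    using that hinged[of C] assms by (force simp: L_def)
  have "Z = (\<Sum>S\<in>Pow X. if S \<in> nonleaf then (h - card S) * A S else 0)"
    unfolding Z_def using finX by (intro sum.mono_neutral_cong_left) (auto simp: nonleaf_def)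
  also have "\<dots> = (if {} \<in> nonleaf then (h - card ({}::'a set)) * A {} else 0) +
     (\<Sum>C\<in>P. \<Sum>S\<in>Pow C - {{}}. if S \<in> nonleaf then (h - card S) * A S else 0)"
    by (rule sum_Pow_partition[OF finX part]) (use refines in \<open>auto split: if_splits\<close>)
  also have "\<dots> = h * A {} + (\<Sum>C\<in>P. if hinges h A C \<ge> 2 then hinges h A C else 0)"
  proof -
    have "(\<Sum>S\<in>Pow C - {{}}. if S \<in> nonleaf then (h - card S) * A S else 0) =
        (if hinges h A C \<ge> 2 then hinges h A C else 0)" if C: "C \<in> P" for C
    proof -
      have "S \<in> nonleaf \<longleftrightarrow> hinges h A C \<ge> 2" if "S \<in> Pow C - {{}}" for S
      proof -
        have "D = C" if "D \<in> P" "S \<subseteq> D" for D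
        proof (rule ccontr)
          assume "D \<noteq> C"
          then have "D \<inter> C = {}" using part that C by (auto simp: partition_on_def disjoint_def)
          then show False using \<open>S \<in> Pow C - {{}}\<close> \<open>S \<subseteq> D\<close> by blast
        qed
        then have "(\<exists>D\<in>P. S \<subseteq> D \<and> hinges h A D \<ge> 2) \<longleftrightarrow> hinges h A C \<ge> 2"
          using C that by blast
        then show ?thesis using that part_subset[OF C] unfolding nonleaf_def by blast
      qed
      then have "(\<Sum>S\<in>Pow C - {{}}. if S \<in> nonleaf then (h - card S) * A S else 0) =
        (\<Sum>S\<in>Pow C - {{}}. if hinges h A C \<ge> 2 then (h - card S) * A S else 0)"
        by (intro sum.cong) auto
      then show ?thesis by (simp add: hinges_def)
    qed
    then show ?thesis by (simp add: nonleaf_def)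
  qed
  also have "(\<Sum>C\<in>P. if hinges h A C \<ge> 2 then hinges h A C else 0) = (\<Sum>C\<in>Q. hinges h A C)"
    unfolding Q_def using finP by (subst sum.inter_filter) auto
  finally have Z: "Z = h * A {} + (\<Sum>C\<in>Q. hinges h A C)" .
  have "(\<Sum>C\<in>P. hinges h A C) = (\<Sum>C\<in>L. hinges h A C) + (\<Sum>C\<in>Q. hinges h A C)"
    unfolding PLQ(1) using fin PLQ(2) by (rule sum.union_disjoint)
  then have ZL: "r * N = Z + card L" using total_parts Z L1 by (simp add: N_def)
  have few: "card L + card Q + A {} \<le> (r - 1) * N + 1"
    using few_parts card_Un_disjoint[OF fin PLQ(2)] PLQ(1) by (simp add: N_def)
  have rN: "r * N = (r - 1) * N + N" using r1 by (cases r) auto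
  have "N \<le> Z"
  proof (cases "card Q + A {} = 0")
    case True
    then have "Z = 0" using Z fin by simp
    then show ?thesis using few ZL rN assms by (simp add: N_def)
  qed (use few ZL rN in linarith)
  then show ?thesis by (simp add: N_def Z_def)
qed

end

text \<open>
  Of the \<open>A S\<close> edges meeting \<open>X\<close> in \<open>S\<close>, \<open>sel S\<close> receive the new vertex \<open>b\<close>. With
  \<open>N = n - card X\<close>, \<open>sel_part\<close> says that at most the ceiling of \<open>d / N\<close> of the \<open>d\<close> hinges of a
  part are used.
\<close>

locale class_step = class_state +
  fixes b :: 'a and sel :: "'a set \<Rightarrow> nat"
  assumes b: "b \<notin> X" and pos: "card X < n"
    and sel_le: "\<And>S. sel S \<le> A S"
    and sel_card: "\<And>S. sel S > 0 \<Longrightarrow> card S < h"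
    and sel_total: "(\<Sum>S\<in>Pow X. sel S) = r"
    and sel_part: "\<And>C. C \<in> P \<Longrightarrow>
        (n - card X) * (\<Sum>S\<in>Pow C - {{}}. sel S) < hinges h A C + (n - card X)"
    and sel_nonleaf: "n - card X \<le> (\<Sum>S\<in>nonleaf. (h - card S) * A S) \<Longrightarrow> \<exists>S\<in>nonleaf. sel S > 0"
begin

definition A' :: "'a set \<Rightarrow> nat" where
  "A' S = (if b \<in> S then sel (S - {b}) else A S - sel S)"

definition touched :: "'a set set" where
  "touched = {C\<in>P. \<exists>S\<in>Pow C - {{}}. sel S > 0}"

definition new_part :: "'a set" where "new_part = insert b (\<Union>touched)"

definition P' :: "'a set set" where "P' = insert new_part (P - touched)"

lemma A'_old: "S \<subseteq> X \<Longrightarrow> A' S = A S - sel S" using b by (auto simp: A'_def)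

lemma A'_new: "S \<subseteq> X \<Longrightarrow> A' (insert b S) = sel S"
proof -
  assume "S \<subseteq> X"
  then have "insert b S - {b} = S" using b by auto
  then show ?thesis by (simp add: A'_def)
qed

lemma sel_support: "sel S > 0 \<Longrightarrow> A S > 0" using sel_le[of S] by linarith

text \<open>A selected edge exchanges one hinge for the end \<open>b\<close>. By
  \<open>sel_card\<close> it has a hinge to give, so the truncated subtraction
  \<open>h - Suc (card S)\<close> is exact where it counts.\<close>

lemma hinge_split: 
  "(h - card S) * A S = (h - card S) * (A S - sel S) + (h - Suc (card S)) * sel S + sel S"
proof (cases "sel S = 0")
  case False
  then obtain k where k: "h - card S = Suc k" using sel_card[of S]
    by (metis Suc_diff_Suc neq0_conv)
  then have "h - Suc (card S) = k" by simp
  obtain a where "A S = sel S + a" using sel_le[of S] le_Suc_ex by blast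
  then show ?thesis unfolding k \<open>h - Suc (card S) = k\<close> by (simp add: algebra_simps)
qed simp

lemma link_mono: "class_link A \<subseteq> class_link A'"
proof
  fix z assume "z \<in> class_link A"
  then obtain x y S where z: "z = (x, y)" "A S > 0" "x \<in> S" "y \<in> S" by (auto simp: class_link_def)
  have "S \<subseteq> X" using support z by blast
  \<comment> \<open>Either some copy of \<open>S\<close> is not selected, or a selected one lives on
    as \<open>insert b S\<close>, which still contains \<open>S\<close>.\<close>
  then have "A' S > 0 \<or> A' (insert b S) > 0" using z by (auto simp: A'_old A'_new)
  then show "z \<in> class_link A'" using z by (auto simp: class_link_def)
qed

lemma new_part_linked: "x \<in> new_part \<Longrightarrow> (x, b) \<in> (class_link A')\<^sup>*"
proof -
  assume "x \<in> new_part"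
  then consider "x = b" | C S where "C \<in> P" "x \<in> C" "S \<subseteq> C" "S \<noteq> {}" "sel S > 0"
    by (auto simp: new_part_def touched_def)
  then show ?thesis
  proof cases
    case 2
    then obtain s where s: "s \<in> S" by auto
    have "S \<subseteq> X" using 2 part_subset by blast
    then have "A' (insert b S) > 0" using 2 by (simp add: A'_new)
    then have "(s, b) \<in> class_link A'" using s by (auto simp: class_link_def)
    moreover have "(x, s) \<in> (class_link A')\<^sup>*"
      using conn[of C x s] 2 s rtrancl_mono[OF link_mono] by blast
    ultimately show ?thesis by (rule rtrancl_into_rtrancl[rotated])
  qed simp
qed

lemma untouched_sel: "C \<in> P - touched \<Longrightarrow> S \<subseteq> C \<Longrightarrow> S \<noteq> {} \<Longrightarrow> sel S = 0"
  by (auto simp: touched_def)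

lemma partition': "partition_on (insert b X) P'"
proof (rule partition_onI)
  show "\<Union>P' = insert b X"
    using part by (auto simp: P'_def new_part_def touched_def partition_on_def)
  fix C D assume CD: "C \<in> P'" "D \<in> P'" "C \<noteq> D"
  have "disjnt C D" if "C \<in> P" "D \<in> P" "C \<noteq> D" for C D
    using part that by (auto simp: partition_on_def disjoint_def disjnt_def)
  moreover have "disjnt new_part C" if "C \<in> P - touched" for C
  proof -
    have "b \<notin> C" using part_subset[of C] b that by blast
    moreover have "C \<inter> D = {}" if "D \<in> touched" for D
      using part \<open>C \<in> P - touched\<close> that
      unfolding touched_def partition_on_def disjoint_def by blast
    ultimately show "disjnt new_part C" unfolding new_part_def disjnt_def by blast
  qed
  ultimately show "disjnt C D" using CD by (auto simp: P'_def disjnt_sym)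
next
  show "{} \<notin> P'" using part by (auto simp: P'_def new_part_def partition_on_def)
qed

text \<open>
  The vertex \<open>b\<close> meets an edge outside \<open>X\<close> or a part with two hinges, and does not use all of them.
\<close>

lemma hinged_new_part:
  assumes "n - card X \<ge> 2"
  shows "hinges h A' new_part > 0"
proof -
  obtain S where S: "S \<in> nonleaf" "sel S > 0"
    using sel_nonleaf nonleaf_heavy[OF assms] by blast
  have "\<exists>S'\<in>Pow new_part - {{}}. (h - card S') * A' S' > 0"
  proof (cases "S = {}")
    case True
    then have "A' {b} > 0" using S by (simp add: A'_def)
    then show ?thesis using h2 by (intro bexI[of _ "{b}"]) (auto simp: new_part_def)
  next
    case False
    then obtain C where C: "C \<in> P" "S \<subseteq> C" "hinges h A C \<ge> 2" using S by (auto simp: nonleaf_def)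
    have CX: "C \<subseteq> X" by (rule part_subset[OF C(1)])
    have "C \<in> touched" using C S False by (auto simp: touched_def)
    then have CB: "C \<subseteq> new_part" by (auto simp: new_part_def)
    show ?thesis
    proof (rule ccontr)
      assume "\<not> ?thesis"
      then have neg: "(h - card T) * A' T = 0" if "T \<in> Pow new_part - {{}}" for T
        using that gr0I by blast
      \<comment> \<open>With no hinge left in the new part, \<open>hinge_split\<close> shows that
        every hinge of \<open>C\<close> was given to \<open>b\<close>.\<close>
      have "(h - card S') * A S' = sel S'" if "S' \<in> Pow C - {{}}" for S'
      proof -
        have "S' \<subseteq> X" using that CX by blast
        have "S' \<in> Pow new_part - {{}}" "insert b S' \<in> Pow new_part - {{}}" 
          using that CB by (auto simp: new_part_def)
        then have "(h - card S') * A' S' = 0" "(h - card (insert b S')) * A' (insert b S') = 0"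
          by (simp_all only: neg)
        moreover have "card (insert b S') = Suc (card S')"
          using \<open>S' \<subseteq> X\<close> b finX finite_subset by (metis card_insert_disjoint in_mono)
        ultimately show ?thesis
          using hinge_split[of S'] \<open>S' \<subseteq> X\<close> by (simp add: A'_old A'_new)
      qed
      then have eq: "hinges h A C = (\<Sum>S\<in>Pow C - {{}}. sel S)" by (simp add: hinges_def)
      define N where "N = n - card X"
      define d where "d = hinges h A C"
      \<comment> \<open>This amounts to \<open>(N - 1) * (d - 1) < 1\<close>, which fails when
        \<open>N\<close> and \<open>d\<close> are both at least 2.\<close>
      have "N * d < d + N" using sel_part[OF C(1)] eq by (simp add: N_def d_def)
      moreover obtain N' d' where "N = N' + 2" "d = d' + 2"
        using assms C(3) by (metis N_def d_def add.commute le_Suc_ex)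
      ultimately show False by (simp add: algebra_simps)
    qed
  qed
  then obtain S' where S': "S' \<in> Pow new_part - {{}}" "(h - card S') * A' S' > 0" by blast
  have "new_part \<subseteq> insert b X" using part_subset by (auto simp: new_part_def touched_def)
  then have "finite new_part" using finX finite_subset by blast
  then show ?thesis unfolding hinges_def using S' by (intro sum_pos2[of _ S']) auto
qed

text \<open>
  With \<open>U = r * N - (card P + A {})\<close>, the ends of \<open>b\<close> fall short of \<open>r\<close> distinct parts by at most
  \<open>U / N\<close>, and \<open>U \<ge> N - 1\<close>.
\<close>

lemma few_parts': "card P' + A' {} \<le> (r - 1) * (n - card (insert b X)) + 1"
proof -
  define N where "N = n - card X"
  define \<sigma> where "\<sigma> C = (\<Sum>S\<in>Pow C - {{}}. sel S)" for C
  have N: "N \<ge> 1" using pos by (simp add: N_def)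
  have finT: "finite touched" "touched \<subseteq> P" using finP by (auto simp: touched_def)
  have "r = sel {} + (\<Sum>C\<in>P. \<sigma> C)"
    unfolding \<sigma>_def sel_total[symmetric]
    by (rule sum_Pow_partition[OF finX part]) (use refines sel_support in auto)
  also have "(\<Sum>C\<in>P. \<sigma> C) = (\<Sum>C\<in>touched. \<sigma> C)"
    using finP by (intro sum.mono_neutral_right) (auto simp: \<sigma>_def touched_def)
  finally have r: "r = sel {} + (\<Sum>C\<in>touched. \<sigma> C)" .
  \<comment> \<open>\<open>\<delta>\<close> counts the wasted ends of \<open>b\<close>: those beyond
    the first in each touched part.\<close>
  define \<delta> where "\<delta> = (\<Sum>C\<in>touched. int (\<sigma> C) - 1)"
  have \<delta>: "\<delta> = int r - int (sel {}) - int (card touched)"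
    by (subst r) (simp add: \<delta>_def sum_subtractf)
  have \<delta>0: "\<delta> \<ge> 0"
    unfolding \<delta>_def
  proof (rule sum_nonneg)
    fix C assume "C \<in> touched"
    then obtain S where "C \<in> P" "S \<in> Pow C - {{}}" "sel S > 0" by (auto simp: touched_def)
    then have "\<sigma> C > 0" unfolding \<sigma>_def using fin_part by (intro sum_pos2[of _ S]) auto
    then show "0 \<le> int (\<sigma> C) - 1" by simp
  qed
  have d1: "hinges h A C \<ge> 1" if "C \<in> P" for C using hinged[OF pos that] by simp
  have "int N * \<delta> = (\<Sum>C\<in>touched. int N * (int (\<sigma> C) - 1))"
    by (simp add: \<delta>_def sum_distrib_left)
  also have "\<dots> \<le> (\<Sum>C\<in>touched. int (hinges h A C) - 1)"
  proof (rule sum_mono)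
    fix C assume "C \<in> touched"
    then have "N * \<sigma> C < hinges h A C + N" using sel_part[of C] finT by (auto simp: N_def \<sigma>_def)
    then have "int (N * \<sigma> C) < int (hinges h A C + N)" by (rule of_nat_less_iff[THEN iffD2])
    then show "int N * (int (\<sigma> C) - 1) \<le> int (hinges h A C) - 1" by (simp add: algebra_simps)
  qed
  also have "\<dots> \<le> (\<Sum>C\<in>P. int (hinges h A C) - 1)"
    using finP finT d1 by (intro sum_mono2) force+
  also have "\<dots> = int (r * N) - int (h * A {}) - int (card P)"
    using total_parts by (simp add: sum_subtractf N_def)
  also have "\<dots> \<le> int (r * N) - int (A {}) - int (card P)"
    using h2 by (cases h) auto
  finally have N\<delta>: "int N * \<delta> \<le> int r * int N - (int (A {}) + int (card P))" by simp
  have "int (card P + A {}) \<le> int ((r - 1) * N + 1)"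
    using few_parts by (metis N_def of_nat_le_iff)
  then have few: "int (card P) + int (A {}) \<le> (int r - 1) * int N + 1"
    using r1 by (simp add: of_nat_diff)
  \<comment> \<open>In terms of \<open>U\<close> the claim is
    \<open>\<delta> \<le> U - (N - 1)\<close>. For \<open>\<delta> = 0\<close> it is
    \<open>few_parts\<close>; otherwise subtract \<open>N - 1 \<le> (N - 1) * \<delta>\<close> from
    \<open>N * \<delta> \<le> U\<close>.\<close>
  have key: "int (card P) + int (A {}) + \<delta> \<le> (int r - 1) * int N + 1"
  proof (cases "\<delta> = 0")
    case False
    then have "(int N - 1) * 1 \<le> (int N - 1) * \<delta>"
      using \<delta>0 N by (intro mult_left_mono) auto
    then show ?thesis using N\<delta> by (simp add: algebra_simps)
  qed (use few in simp)
  \<comment> \<open>The touched parts fuse into one and \<open>sel {}\<close> edges gain the vertex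
    \<open>b\<close>, so the quantity bounded by the invariant becomes at most
    \<open>card P + A {} + \<delta> - (r - 1)\<close>.\<close>
  have "card P' \<le> Suc (card (P - touched))" unfolding P'_def by (rule card_insert_le_m1) auto
  moreover have "int (card (P - touched)) = int (card P) - int (card touched)"
    using finT finP by (simp add: card_Diff_subset card_mono of_nat_diff)
  moreover have "int (A' {}) = int (A {}) - int (sel {})" using sel_le[of "{}"] by (simp add: A'_def)
  ultimately have "int (card P' + A' {}) \<le> (int r - 1) * (int N - 1) + 1"
    using key \<delta> by (simp add: algebra_simps)
  also have "\<dots> = int ((r - 1) * (N - 1) + 1)"
    using r1 N by (simp add: of_nat_diff)
  also have "N - 1 = n - card (insert b X)" using b finX by (simp add: N_def)
  finally show ?thesis by (simp only: of_nat_le_iff)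
qed

theorem class_state': "class_state h r n (insert b X) A' P'"
proof
  show "2 \<le> h" "1 \<le> r" by (rule h2, rule r1)
  show "finite (insert b X)" using finX by simp
  have card_ins: "card (insert b X) = Suc (card X)" using finX b by simp
  show "card (insert b X) \<le> n" using pos card_ins by simp
  show "S \<subseteq> insert b X \<and> card S \<le> h" if "A' S > 0" for S
  proof (cases "b \<in> S")
    case True
    then have s: "sel (S - {b}) > 0" using that by (simp add: A'_def)
    then have "S - {b} \<subseteq> X" using sel_support support by blast
    moreover have "finite S"
      using finite_subset[OF \<open>S - {b} \<subseteq> X\<close> finX] by simp
    ultimately show ?thesis using sel_card[OF s] True by (auto simp: card_Diff_singleton_if)
  next
    case False
    then show ?thesis using that support[of S] by (auto simp: A'_def)
  qed
  show "(\<Sum>S\<in>Pow (insert b X). if v \<in> S then A' S else 0) = r" if "v \<in> insert b X" for v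
  proof (cases "v = b")
    case True
    have "(\<Sum>S\<in>Pow X. (if v \<in> S then A' S else 0) + (if v \<in> insert b S then A' (insert b S) else 0))
        = (\<Sum>S\<in>Pow X. sel S)"
      using True b by (intro sum.cong) (auto simp: A'_new)
    then show ?thesis using finX b sel_total by (simp add: sum_Pow_insert)
  next
    case False
    have "(\<Sum>S\<in>Pow X. (if v \<in> S then A' S else 0) + (if v \<in> insert b S then A' (insert b S) else 0))
        = (\<Sum>S\<in>Pow X. if v \<in> S then A S else 0)"
      using False sel_le by (intro sum.cong) (auto simp: A'_new A'_old)
    then show ?thesis using finX b deg[of v] that False by (simp add: sum_Pow_insert)
  qed
  show "(\<Sum>S\<in>Pow (insert b X). (h - card S) * A' S) = r * (n - card (insert b X))"
  proof -
    have "(\<Sum>S\<in>Pow X. (h - card S) * A S) =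
      (\<Sum>S\<in>Pow X. (h - card S) * A' S + (h - card (insert b S)) * A' (insert b S)) + (\<Sum>S\<in>Pow X. sel S)"
      unfolding sum.distrib[symmetric]
    proof (rule sum.cong[OF refl])
      fix S assume "S \<in> Pow X"
      then have "card (insert b S) = Suc (card S)"
        using b finX finite_subset by (metis PowD card_insert_disjoint in_mono)
      then show "(h - card S) * A S =
         (h - card S) * A' S + (h - card (insert b S)) * A' (insert b S) + sel S"
        using hinge_split[of S] \<open>S \<in> Pow X\<close> by (simp add: A'_old A'_new)
    qed
    then have "r * (n - card X) = (\<Sum>S\<in>Pow (insert b X). (h - card S) * A' S) + r"
      using total sel_total finX b by (simp add: sum_Pow_insert)
    moreover have "n - card X = Suc (n - card (insert b X))" using card_ins pos by simp
    ultimately show ?thesis by simp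
  qed
  show "partition_on (insert b X) P'" by (rule partition')
  show "\<exists>C\<in>P'. S \<subseteq> C" if "A' S > 0" "S \<noteq> {}" for S
  proof (cases "b \<in> S")
    case True
    then have s: "sel (S - {b}) > 0" using that by (simp add: A'_def)
    have "S \<subseteq> new_part"
    proof (cases "S - {b} = {}")
      case False
      then obtain C where "C \<in> P" "S - {b} \<subseteq> C" using refines[OF sel_support[OF s]] by blast
      then have "C \<in> touched" using False s unfolding touched_def by blast
      then show ?thesis using \<open>S - {b} \<subseteq> C\<close> by (auto simp: new_part_def)
    qed (auto simp: new_part_def)
    then show ?thesis by (auto simp: P'_def)
  next
    case False
    then have "A S > 0" using that by (simp add: A'_def)
    then obtain C where "C \<in> P" "S \<subseteq> C" using refines \<open>S \<noteq> {}\<close> by blast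
    then show ?thesis by (cases "C \<in> touched") (auto simp: P'_def new_part_def)
  qed
  show "(x, y) \<in> (class_link A')\<^sup>*" if "C \<in> P'" "x \<in> C" "y \<in> C" for C x y
  proof (cases "C = new_part")
    case True
    then show ?thesis
      using that new_part_linked sym_class_link_rtrancl by (meson rtrancl_trans)
  next
    case False
    then have "C \<in> P" using that by (simp add: P'_def)
    then show ?thesis using conn that rtrancl_mono[OF link_mono] by blast
  qed
  show "hinges h A' C > 0" if "card (insert b X) < n" "C \<in> P'" for C
  proof (cases "C = new_part")
    case True
    then show ?thesis using hinged_new_part that card_ins by simp
  next
    case False
    then have C: "C \<in> P - touched" using that by (simp add: P'_def)
    have "hinges h A' C = hinges h A C"
      unfolding hinges_def
    proof (rule sum.cong[OF refl])
      fix S assume "S \<in> Pow C - {{}}"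
      then have "sel S = 0" "S \<subseteq> X" using untouched_sel[OF C] part_subset C by auto
      then show "(h - card S) * A' S = (h - card S) * A S" by (simp add: A'_old)
    qed
    then show ?thesis using hinged[OF pos] C by simp
  qed
  show "card P' + A' {} \<le> (r - 1) * (n - card (insert b X)) + 1" by (rule few_parts')
qed

end

section \<open>Splitting off all new vertices\<close>

lemma rounds_to_nonneg: "rounds_to x y \<Longrightarrow> 0 \<le> x \<Longrightarrow> 0 \<le> y"
  by (simp add: rounds_to_def) (meson order_trans zero_le_floor)

text \<open>The missing ends of an edge are distinct vertices among the \<open>n - card X\<close>
  merged ones, which gives the binomial coefficient. When \<open>X\<close> has \<open>n\<close>
  elements it leaves exactly \<open>lam\<close> copies of each \<open>h\<close>-subset and none of
  the smaller sets.\<close>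

definition stage ::
  "nat \<Rightarrow> nat \<Rightarrow> nat \<Rightarrow> nat \<Rightarrow> nat set \<Rightarrow> 'a set \<Rightarrow> (nat \<Rightarrow> 'a set \<Rightarrow> nat) \<Rightarrow> bool" where
  "stage h r n lam K X M \<longleftrightarrow> (\<forall>i\<in>K. \<exists>P. class_state h r n X (M i) P) \<and>
     (\<forall>S\<in>Pow X. card S \<le> h \<longrightarrow> (\<Sum>i\<in>K. M i S) = lam * ((n - card X) choose (h - card S)))"

text \<open>The cells to be rounded are the pairs of a colour and a set \<open>S\<close>, with value
  \<open>(h - card S) * M i S / N\<close>. Totals per set and per colour are whole numbers, hence
  kept exactly; totals per part and per nonleaf family are kept up to rounding, which yields
  \<open>sel_part\<close> and \<open>sel_nonleaf\<close>.\<close>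

lemma stage_step:
  fixes M :: "nat \<Rightarrow> 'a set \<Rightarrow> nat"
  assumes finK: "finite K" and finX: "finite X" and st: "stage h r n lam K X M"
    and pos: "card X < n" and b: "b \<notin> X"
  shows "\<exists>M'. stage h r n lam K (insert b X) M' \<and>
           (\<forall>i\<in>K. \<forall>S. S \<subseteq> X \<longrightarrow> card S = h \<longrightarrow> M' i S = M i S)"
proof -
  define N where "N = n - card X"
  have N: "N \<ge> 1" using pos by (simp add: N_def)
  from st obtain P where P: "\<And>i. i \<in> K \<Longrightarrow> class_state h r n X (M i) (P i)"
    unfolding stage_def by metis
  have col: "(\<Sum>i\<in>K. M i S) = lam * (N choose (h - card S))" if "S \<subseteq> X" "card S \<le> h" for S
    using st that by (simp add: stage_def N_def)
  define E where "E = {(i, S). i \<in> K \<and> S \<in> Pow X \<and> M i S > 0}"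
  have finE: "finite E"
    by (rule finite_subset[of _ "K \<times> Pow X"]) (use finK finX in \<open>auto simp: E_def\<close>)
  define x where "x e = real ((h - card (snd e)) * M (fst e) (snd e)) / N" for e :: "nat \<times> 'a set"
  \<comment> \<open>For a nonempty \<open>S\<close> of positive multiplicity the union is the one
    part that contains \<open>S\<close>; for \<open>S = {}\<close> it is empty and so differs from
    every part.\<close>
  define lab where "lab e = (fst e, \<Union>{C \<in> P (fst e). C \<inter> snd e \<noteq> {}})" for e :: "nat \<times> 'a set"
  \<comment> \<open>Within a colour the flag is true exactly for the labels of nonleaf edges; the
    label \<open>{}\<close> of edges without vertices in \<open>X\<close> is included.\<close>
  define grp where "grp u = (fst u, snd u = {} \<or> hinges h (M (fst u)) (snd u) \<ge> 2)"
    for u :: "nat \<times> 'a set"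
  obtain y :: "nat \<times> 'a set \<Rightarrow> int" where y:
    "\<And>e. e \<in> E \<Longrightarrow> rounds_to (x e) (y e)"
    "\<And>u. rounds_to (\<Sum>e\<in>{e\<in>E. snd e = u}. x e) (\<Sum>e\<in>{e\<in>E. snd e = u}. y e)"
    "\<And>u. rounds_to (\<Sum>e\<in>{e\<in>E. lab e = u}. x e) (\<Sum>e\<in>{e\<in>E. lab e = u}. y e)"
    "\<And>u. rounds_to (\<Sum>e\<in>{e\<in>E. grp (lab e) = u}. x e) (\<Sum>e\<in>{e\<in>E. grp (lab e) = u}. y e)"
    "\<And>u. rounds_to (\<Sum>e\<in>{e\<in>E. fst (grp (lab e)) = u}. x e) (\<Sum>e\<in>{e\<in>E. fst (grp (lab e)) = u}. y e)"
    using hierarchical_rounding[OF finE, of x snd lab grp fst] by blast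
  define sel where "sel i S = (if (i, S) \<in> E then nat (y (i, S)) else 0)" for i S
  have y_nonneg: "y e \<ge> 0" if "e \<in> E" for e
    using rounds_to_nonneg[OF y(1)[OF that]] by (simp add: x_def)
  \<comment> \<open>Transfers a rounded total over the cells picked by \<open>R\<close> to sums over
    a family of sets; sets of multiplicity 0 are not in \<open>E\<close> and add nothing to either
    side.\<close>
  have conv: "rounds_to (real (\<Sum>S\<in>\<S>. (h - card S) * M i S) / N) (int (\<Sum>S\<in>\<S>. sel i S))"
    if "i \<in> K" "\<S> \<subseteq> Pow X" and R: "\<And>S. S \<in> Pow X \<Longrightarrow> M i S > 0 \<Longrightarrow> R (i, S) \<longleftrightarrow> S \<in> \<S>"
      and "\<And>e. R e \<Longrightarrow> fst e = i"
      and "rounds_to (\<Sum>e\<in>{e\<in>E. R e}. x e) (\<Sum>e\<in>{e\<in>E. R e}. y e)" for i \<S> R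
  proof -
    have eq: "{e\<in>E. R e} = Pair i ` {S\<in>\<S>. M i S > 0}"
    proof (rule set_eqI)
      fix e :: "nat \<times> 'a set"
      obtain j S where e: "e = (j, S)" by (cases e)
      show "e \<in> {e\<in>E. R e} \<longleftrightarrow> e \<in> Pair i ` {S\<in>\<S>. M i S > 0}"
        using that(1,2) R[of S] that(4)[of e] unfolding e E_def by auto
    qed
    have fin: "finite \<S>" using that(2) finX finite_subset by blast
    have "(\<Sum>e\<in>{e\<in>E. R e}. x e) = (\<Sum>S\<in>{S\<in>\<S>. M i S > 0}. x (i, S))"
      unfolding eq by (subst sum.reindex) (auto simp: inj_on_def)
    also have "\<dots> = (\<Sum>S\<in>\<S>. x (i, S))"
      using fin by (intro sum.mono_neutral_left) (auto simp: x_def)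
    also have "\<dots> = real (\<Sum>S\<in>\<S>. (h - card S) * M i S) / N"
      by (simp add: x_def sum_divide_distrib)
    finally have 1: "(\<Sum>e\<in>{e\<in>E. R e}. x e) = real (\<Sum>S\<in>\<S>. (h - card S) * M i S) / N" .
    have "(\<Sum>e\<in>{e\<in>E. R e}. y e) = (\<Sum>S\<in>{S\<in>\<S>. M i S > 0}. y (i, S))"
      unfolding eq by (subst sum.reindex) (auto simp: inj_on_def)
    also have "\<dots> = (\<Sum>S\<in>{S\<in>\<S>. M i S > 0}. int (sel i S))"
    proof (rule sum.cong[OF refl])
      fix S assume "S \<in> {S\<in>\<S>. M i S > 0}"
      then have "(i, S) \<in> E" using that(1,2) by (auto simp: E_def)
      then show "y (i, S) = int (sel i S)" using y_nonneg by (simp add: sel_def)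
    qed
    also have "\<dots> = (\<Sum>S\<in>\<S>. int (sel i S))"
      using fin by (intro sum.mono_neutral_left) (auto simp: sel_def E_def)
    finally have 2: "(\<Sum>e\<in>{e\<in>E. R e}. y e) = int (\<Sum>S\<in>\<S>. sel i S)" by simp
    show ?thesis using that(5) unfolding 1 2 .
  qed
  have sel_E: "sel i S > 0 \<Longrightarrow> (i, S) \<in> E" for i S by (auto simp: sel_def split: if_splits)
  have step: "class_step h r n X (M i) (P i) b (sel i)" if i: "i \<in> K" for i
  proof -
    interpret class_state h r n X "M i" "P i" by (rule P[OF i])
    have lab_part: "snd (lab (i, S)) = C \<longleftrightarrow> S \<subseteq> C" if "M i S > 0" "S \<noteq> {}" "C \<in> P i" for S C
    proof -
      have "\<exists>D\<in>P i. S \<subseteq> D" using refines that by blast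
      then obtain D where D: "D \<in> P i" "S \<subseteq> D" by blast
      have uniq: "C' = D" if "C' \<in> P i" "C' \<inter> S \<noteq> {}" for C'
        using that D part unfolding partition_on_def disjoint_def by blast
      have "{C \<in> P i. C \<inter> S \<noteq> {}} = {D}" using uniq D that(2) by auto
      then have "snd (lab (i, S)) = D" by (simp add: lab_def)
      then show ?thesis using D uniq[of C] that by (auto simp: inf.absorb_iff2 Int_commute)
    qed
    have lab_fst: "fst (lab (i, S)) = i" for S by (simp add: lab_def)
    have lab_empty: "lab (i, {}) = (i, {})" by (simp add: lab_def)
    have part_ne: "C \<noteq> {}" if "C \<in> P i" for C using part that by (auto simp: partition_on_def)
    have lab_in: "snd (lab (i, S)) \<in> P i" if "M i S > 0" "S \<noteq> {}" for S
      using refines[OF that] lab_part[OF that] by metis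
    show ?thesis
    proof
      show "b \<notin> X" "card X < n" by (rule b, rule pos)
      show "sel i S \<le> M i S" for S
      proof (cases "(i, S) \<in> E")
        case True
        then have S: "S \<subseteq> X" "M i S > 0" by (auto simp: E_def)
        then have "card S \<le> h" using support by blast
        \<comment> \<open>An edge that occurs at all makes \<open>N choose (h - card S)\<close>
          nonzero, so \<open>h - card S \<le> N\<close> and at most the fraction 1 of the copies is
          selected.\<close>
        have "0 < (\<Sum>i\<in>K. M i S)" using finK i S by (intro sum_pos2[of _ i]) auto
        then have "h - card S \<le> N" using col[OF S(1) \<open>card S \<le> h\<close>]
          by (metis binomial_eq_0 mult_0_right not_le_imp_less less_numeral_extra(3))
        then have "x (i, S) \<le> real (M i S)"
          using N by (simp add: x_def divide_le_eq mult.commute flip: of_nat_mult)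
        then have "\<lceil>x (i, S)\<rceil> \<le> int (M i S)" by (simp add: ceiling_le_iff)
        then have "y (i, S) \<le> int (M i S)" using y(1)[OF True] unfolding rounds_to_def by linarith
        then show ?thesis using True by (simp add: sel_def)
      qed (simp add: sel_def)
      show "card S < h" if "sel i S > 0" for S
      proof (rule ccontr)
        assume "\<not> card S < h"
        then have "x (i, S) = 0" by (simp add: x_def)
        then show False using y(1)[OF sel_E[OF that]] that by (simp add: sel_def split: if_splits)
      qed
      have "rounds_to (real (\<Sum>S\<in>Pow X. (h - card S) * M i S) / N) (int (\<Sum>S\<in>Pow X. sel i S))"
        by (rule conv[OF i subset_refl _ _ y(5)[of i]]) (auto simp: lab_def grp_def)
      moreover have "real (\<Sum>S\<in>Pow X. (h - card S) * M i S) / N = real r"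
        unfolding total N_def[symmetric] using N by simp
      ultimately show "(\<Sum>S\<in>Pow X. sel i S) = r" by (simp only: rounds_to_of_nat of_nat_eq_iff)
      show "(n - card X) * (\<Sum>S\<in>Pow C - {{}}. sel i S) < hinges h (M i) C + (n - card X)"
        if C: "C \<in> P i" for C
      proof -
        define Y where "Y = (\<Sum>S\<in>Pow C - {{}}. sel i S)"
        have "rounds_to (real (\<Sum>S\<in>Pow C - {{}}. (h - card S) * M i S) / N) (int (\<Sum>S\<in>Pow C - {{}}. sel i S))"
        proof (rule conv[OF i _ _ _ y(3)[of "(i, C)"]])
          show "Pow C - {{}} \<subseteq> Pow X" using part_subset[OF C] by blast
          show "lab (i, S) = (i, C) \<longleftrightarrow> S \<in> Pow C - {{}}" if "S \<in> Pow X" "M i S > 0" for S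
          proof (cases "S = {}")
            case True
            then show ?thesis using part_ne[OF C] by (auto simp: lab_empty)
          next
            case False
            then show ?thesis using lab_part[OF that(2) False C] lab_fst[of S] by (metis DiffI Pow_iff DiffD1 prod.collapse prod.inject singletonD)
          qed
        qed (auto simp: lab_def)
        then have "int Y \<le> \<lceil>real (hinges h (M i) C) / N\<rceil>" unfolding rounds_to_def hinges_def Y_def by blast
        then have "real Y < real (hinges h (M i) C) / N + 1" by linarith
        then have "real N * real Y < real (hinges h (M i) C) + N"
          using N by (simp add: field_simps)
        then have "real (N * Y) < real (hinges h (M i) C + N)" by simp
        then have "N * Y < hinges h (M i) C + N" by (simp only: of_nat_less_iff)
        then show ?thesis by (simp add: N_def Y_def)
      qed
      show "\<exists>S\<in>nonleaf. sel i S > 0" if heavy: "n - card X \<le> (\<Sum>S\<in>nonleaf. (h - card S) * M i S)"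
      proof -
        have "rounds_to (real (\<Sum>S\<in>nonleaf. (h - card S) * M i S) / N) (int (\<Sum>S\<in>nonleaf. sel i S))"
        proof (rule conv[OF i _ _ _ y(4)[of "(i, True)"]])
          show "nonleaf \<subseteq> Pow X" by (auto simp: nonleaf_def)
          show "grp (lab (i, S)) = (i, True) \<longleftrightarrow> S \<in> nonleaf" if "S \<in> Pow X" "M i S > 0" for S
          proof (cases "S = {}")
            case True
            then show ?thesis by (auto simp: lab_empty grp_def nonleaf_def)
          next
            case False
            define D where "D = snd (lab (i, S))"
            have D: "D \<in> P i" using lab_in[OF that(2) False] by (simp add: D_def)
            have "S \<in> nonleaf \<longleftrightarrow> hinges h (M i) D \<ge> 2"
              using lab_part[OF that(2) False] D False that(1)
              unfolding nonleaf_def D_def by auto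
            then show ?thesis using part_ne[OF D] by (auto simp: grp_def lab_fst D_def[symmetric])
          qed
        qed (auto simp: lab_def grp_def)
        moreover have "\<lfloor>real (\<Sum>S\<in>nonleaf. (h - card S) * M i S) / N\<rfloor> \<ge> 1"
          using heavy N by (simp add: le_floor_iff le_divide_eq N_def[symmetric] del: of_nat_sum)
        ultimately have "1 \<le> int (\<Sum>S\<in>nonleaf. sel i S)" unfolding rounds_to_def by linarith
        then have "(\<Sum>S\<in>nonleaf. sel i S) \<noteq> 0" by (intro notI) simp
        then show ?thesis by (meson gr0I sum.neutral)
      qed
    qed
  qed
  define M' where "M' i = class_step.A' (M i) b (sel i)" for i
  have M': "M' i S = (if b \<in> S then sel i (S - {b}) else M i S - sel i S)" if "i \<in> K" for i S
    unfolding M'_def by (rule class_step.A'_def[OF step[OF that]])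
  have sel_le: "sel i S \<le> M i S" if "i \<in> K" for i S by (rule class_step.sel_le[OF step[OF that]])
  have sel0: "sel i S = 0" if "i \<in> K" "card S = h" for i S
    using class_step.sel_card[OF step[OF that(1)], of S] that(2) by auto
  have colsel: "(\<Sum>i\<in>K. sel i S) = lam * ((N - 1) choose (h - Suc (card S)))"
    if S: "S \<subseteq> X" "card S < h" for S
  proof -
    have eq: "{e\<in>E. snd e = S} = (\<lambda>i. (i, S)) ` {i\<in>K. M i S > 0}"
      using S by (auto simp: E_def)
    have "(\<Sum>e\<in>{e\<in>E. snd e = S}. x e) = (\<Sum>i\<in>{i\<in>K. M i S > 0}. x (i, S))"
      unfolding eq by (subst sum.reindex) (auto simp: inj_on_def)
    also have "\<dots> = (\<Sum>i\<in>K. x (i, S))"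
      using finK by (intro sum.mono_neutral_left) (auto simp: x_def)
    also have "\<dots> = real ((h - card S) * (\<Sum>i\<in>K. M i S)) / N"
      by (simp add: x_def sum_divide_distrib sum_distrib_left)
    also have "(h - card S) * (\<Sum>i\<in>K. M i S) = lam * ((h - card S) * (N choose (h - card S)))"
      using col S by simp
    \<comment> \<open>Absorption makes the total over the colours a whole number, namely the
      multiplicity required of \<open>insert b S\<close> at the next stage.\<close>
    also have "(h - card S) * (N choose (h - card S)) = N * ((N - 1) choose (h - Suc (card S)))"
      using S by (subst times_binomial_minus1_eq) auto
    also have "real (lam * (N * ((N - 1) choose (h - Suc (card S))))) / N =
        real (lam * ((N - 1) choose (h - Suc (card S))))" using N by simp
    finally have 1: "(\<Sum>e\<in>{e\<in>E. snd e = S}. x e) = real (lam * ((N - 1) choose (h - Suc (card S))))" .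
    have "(\<Sum>e\<in>{e\<in>E. snd e = S}. y e) = (\<Sum>i\<in>{i\<in>K. M i S > 0}. y (i, S))"
      unfolding eq by (subst sum.reindex) (auto simp: inj_on_def)
    also have "\<dots> = (\<Sum>i\<in>{i\<in>K. M i S > 0}. int (sel i S))"
    proof (rule sum.cong[OF refl])
      fix i assume "i \<in> {i\<in>K. M i S > 0}"
      then have "(i, S) \<in> E" using S by (auto simp: E_def)
      then show "y (i, S) = int (sel i S)" using y_nonneg by (simp add: sel_def)
    qed
    also have "\<dots> = (\<Sum>i\<in>K. int (sel i S))"
      using finK by (intro sum.mono_neutral_left) (auto simp: sel_def E_def)
    finally have 2: "(\<Sum>e\<in>{e\<in>E. snd e = S}. y e) = int (\<Sum>i\<in>K. sel i S)" by simp
    show ?thesis using y(2)[of S] unfolding 1 2 rounds_to_of_nat by (simp only: of_nat_eq_iff)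
  qed
  have card_ins: "card (insert b X) = Suc (card X)" using finX b by simp
  then have N1: "n - card (insert b X) = N - 1" by (simp add: N_def)
  have "stage h r n lam K (insert b X) M'"
    unfolding stage_def
  proof (intro conjI ballI impI)
    fix i assume i: "i \<in> K"
    show "\<exists>P. class_state h r n (insert b X) (M' i) P"
      using class_step.class_state'[OF step[OF i]] unfolding M'_def by blast
  next
    fix S assume S: "S \<in> Pow (insert b X)" "card S \<le> h"
    show "(\<Sum>i\<in>K. M' i S) = lam * ((n - card (insert b X)) choose (h - card S))"
    proof (cases "b \<in> S")
      case True
      have T: "S - {b} \<subseteq> X" using S by auto
      have "finite S" using S finX by (metis PowD finite_insert finite_subset)
      then have cT: "Suc (card (S - {b})) = card S" using True by (rule card_Suc_Diff1)
      have "(\<Sum>i\<in>K. M' i S) = (\<Sum>i\<in>K. sel i (S - {b}))"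
        using True by (intro sum.cong) (auto simp: M')
      then show ?thesis using colsel[OF T] cT S(2) N1 by simp
    next
      case False
      then have SX: "S \<subseteq> X" using S by auto
      have "(\<Sum>i\<in>K. M' i S) = (\<Sum>i\<in>K. M i S - sel i S)"
        using False by (intro sum.cong) (auto simp: M')
      also have "\<dots> = (\<Sum>i\<in>K. M i S) - (\<Sum>i\<in>K. sel i S)"
        using sel_le by (intro sum_subtractf_nat) auto
      also have "\<dots> = lam * ((N - 1) choose (h - card S))"
      proof (cases "card S = h")
        case True
        then show ?thesis using col[OF SX S(2)] sel0 by simp
      next
        case False
        then have lt: "card S < h" using S(2) by simp
        \<comment> \<open>What remains at \<open>S\<close> is then right by Pascal's rule for
          \<open>N choose (h - card S)\<close>.\<close>
        obtain N' k where "N = Suc N'" "h - card S = Suc k"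
          using N lt by (metis Suc_diff_Suc Suc_le_D One_nat_def)
        moreover from this have "h - Suc (card S) = k" by simp
        ultimately show ?thesis using col[OF SX S(2)] colsel[OF SX lt] by (simp add: algebra_simps)
      qed
      finally show ?thesis using N1 by simp
    qed
  qed
  moreover have "M' i S = M i S" if "i \<in> K" "S \<subseteq> X" "card S = h" for i S
    using that b sel0 by (auto simp: M')
  ultimately show ?thesis by blast
qed

text \<open>Iterates \<open>stage_step\<close>. An edge with all its \<open>h\<close> vertices in
  place has no hinge, is never selected and so keeps its colour.\<close>

theorem detachment:
  fixes M :: "nat \<Rightarrow> 'a set \<Rightarrow> nat"
  assumes "finite K" "finite V" "card V = n" "X \<subseteq> V" "stage h r n lam K X M"
  shows "\<exists>M'. stage h r n lam K V M' \<and> (\<forall>i\<in>K. \<forall>S. S \<subseteq> X \<longrightarrow> card S = h \<longrightarrow> M' i S = M i S)"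
  using assms(4,5)
proof (induction "card (V - X)" arbitrary: X M)
  case 0
  then have "X = V" using assms(2) by auto
  then show ?case using 0 by blast
next
  case (Suc k)
  then obtain b where b: "b \<in> V - X" by (metis card.empty equals0I nat.distinct(1))
  have finX: "finite X" using Suc.prems assms(2) finite_subset by blast
  have "card X < n" using Suc.prems b assms(2,3) psubset_card_mono[of V X] by blast
  then obtain M1 where M1: "stage h r n lam K (insert b X) M1"
    "\<forall>i\<in>K. \<forall>S. S \<subseteq> X \<longrightarrow> card S = h \<longrightarrow> M1 i S = M i S"
    using stage_step[OF assms(1) finX Suc.prems(2)] b by blast
  have "V - insert b X = (V - X) - {b}" by auto
  then have "k = card (V - insert b X)" using Suc.hyps(2) b assms(2) by simp
  moreover have "insert b X \<subseteq> V" using Suc.prems(1) b by blast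
  ultimately obtain M' where "stage h r n lam K V M'"
    "\<forall>i\<in>K. \<forall>S. S \<subseteq> insert b X \<longrightarrow> card S = h \<longrightarrow> M' i S = M1 i S"
    using Suc.hyps(1)[OF _ _ M1(1)] by blast
  then show ?case using M1(2) by (metis subset_insertI2)
qed

section \<open>Colouring the amalgamated hypergraph\<close>

definition vdegree :: "'a set \<Rightarrow> ('a set \<Rightarrow> nat) \<Rightarrow> 'a \<Rightarrow> nat" where
  "vdegree W A v = (\<Sum>S\<in>Pow W. if v \<in> S then A S else 0)"

lemma vdegree_sum: "(\<Sum>i\<in>K. vdegree W (M i) v) = vdegree W (\<lambda>S. \<Sum>i\<in>K. M i S) v"
  unfolding vdegree_def by (subst sum.swap) (auto intro!: sum.cong)

lemma vdegree_strict_mono: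
  assumes "finite W" "\<And>S. S \<in> Pow W \<Longrightarrow> A S \<le> B S" "S0 \<in> Pow W" "v \<in> S0" "A S0 < B S0"
  shows "vdegree W A v < vdegree W B v"
  unfolding vdegree_def using assms by (intro sum_strict_mono_ex1) auto

lemma sum_vdegree:
  assumes "finite W"
  shows "(\<Sum>v\<in>W. vdegree W A v) = (\<Sum>S\<in>Pow W. card S * A S)"
proof -
  have "(\<Sum>v\<in>W. vdegree W A v) = (\<Sum>S\<in>Pow W. \<Sum>v\<in>W. if v \<in> S then A S else 0)"
    unfolding vdegree_def by (rule sum.swap)
  also have "\<dots> = (\<Sum>S\<in>Pow W. card S * A S)"
  proof (rule sum.cong[OF refl])
    fix S assume "S \<in> Pow W"
    then have "W \<inter> S = S" by auto
    then show "(\<Sum>v\<in>W. if v \<in> S then A S else 0) = card S * A S"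
      using assms by (simp add: sum.inter_restrict[symmetric])
  qed
  finally show ?thesis .
qed

text \<open>While a copy of \<open>S0\<close> is uncoloured, the degrees at a vertex of
  \<open>S0\<close> add up to less than \<open>D\<close> over all colours, so fewer than
  \<open>D / r\<close> colours are full there. Hence \<open>card S0 * D \<le> r * card K\<close>
  leaves a colour that is full at no vertex of \<open>S0\<close>. Sets that have reached their
  target are never touched, so earlier rounds survive.\<close>

lemma greedy_colouring:
  fixes M :: "nat \<Rightarrow> 'a set \<Rightarrow> nat"
  assumes finK: "finite K" and finW: "finite W"
    and T: "\<And>S. S \<in> Pow W \<Longrightarrow> (\<Sum>i\<in>K. M i S) \<le> T S"
    and deg: "\<And>i v. i \<in> K \<Longrightarrow> v \<in> W \<Longrightarrow> vdegree W (M i) v \<le> r"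
    and D: "\<And>v. v \<in> W \<Longrightarrow> vdegree W T v \<le> D"
    and room: "\<And>S. S \<in> Pow W \<Longrightarrow> (\<Sum>i\<in>K. M i S) < T S \<Longrightarrow> S \<noteq> {} \<and> card S * D \<le> r * card K"
  shows "\<exists>M'. (\<forall>S\<in>Pow W. (\<Sum>i\<in>K. M' i S) = T S) \<and>
      (\<forall>i\<in>K. \<forall>v\<in>W. vdegree W (M' i) v \<le> r) \<and>
      (\<forall>i S. S \<notin> Pow W \<or> (\<Sum>i\<in>K. M i S) = T S \<longrightarrow> M' i S = M i S)"
  using T deg room
proof (induction "\<Sum>S\<in>Pow W. T S - (\<Sum>i\<in>K. M i S)" arbitrary: M rule: less_induct)
  case less
  show ?case
  proof (cases "\<forall>S\<in>Pow W. (\<Sum>i\<in>K. M i S) = T S")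
    case True
    then show ?thesis using less.prems(2) by (intro exI[of _ M]) auto
  next
    case False
    then obtain S0 where S0: "S0 \<in> Pow W" "(\<Sum>i\<in>K. M i S0) < T S0"
      using less.prems(1) by (metis le_neq_implies_less)
    then have ne: "S0 \<noteq> {}" and S0D: "card S0 * D \<le> r * card K" using less.prems(3) by blast+
    have finS0: "finite S0" using S0 finW finite_subset by blast
    define full where "full v = {i\<in>K. vdegree W (M i) v = r}" for v
    have full: "r * card (full v) < D" if v: "v \<in> S0" for v
    proof -
      have "r * card (full v) = (\<Sum>i\<in>full v. vdegree W (M i) v)" by (simp add: full_def)
      also have "\<dots> \<le> (\<Sum>i\<in>K. vdegree W (M i) v)"
        using finK by (intro sum_mono2) (auto simp: full_def)
      also have "\<dots> < vdegree W T v"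
        unfolding vdegree_sum
        using less.prems(1) S0 v by (intro vdegree_strict_mono[OF finW, where ?S0.0 = S0]) auto
      also have "\<dots> \<le> D" using D v S0 by blast
      finally show ?thesis .
    qed
    have "r * card (\<Union>v\<in>S0. full v) \<le> r * (\<Sum>v\<in>S0. card (full v))"
      using finS0 by (intro mult_left_mono card_UN_le) auto
    also have "\<dots> < (\<Sum>v\<in>S0. D)"
      unfolding sum_distrib_left by (rule sum_strict_mono[OF finS0 ne full])
    also have "\<dots> \<le> r * card K" using S0D by simp
    finally have "card (\<Union>v\<in>S0. full v) < card K" by simp
    moreover have "finite (\<Union>v\<in>S0. full v)" using finS0 finK by (simp add: full_def)
    ultimately have "\<not> K \<subseteq> (\<Union>v\<in>S0. full v)" using card_mono linorder_not_le by blast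
    then obtain i where i: "i \<in> K" "i \<notin> (\<Union>v\<in>S0. full v)" by blast
    have lt: "vdegree W (M i) v < r" if "v \<in> S0" for v
    proof -
      have "vdegree W (M i) v \<noteq> r" using i that by (auto simp: full_def)
      then show ?thesis using less.prems(2)[of i v] i(1) that S0(1) by fastforce
    qed
    define M1 where "M1 = M(i := (M i)(S0 := Suc (M i S0)))"
    have M1: "M1 j S = M j S + (if j = i \<and> S = S0 then 1 else 0)" for j S by (simp add: M1_def)
    have tot: "(\<Sum>j\<in>K. M1 j S) = (\<Sum>j\<in>K. M j S) + (if S = S0 then 1 else 0)" for S
      using finK i(1) by (cases "S = S0") (simp_all add: M1 sum.distrib)
    have deg1: "vdegree W (M1 j) v = vdegree W (M j) v + (if j = i \<and> v \<in> S0 then 1 else 0)" for j v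
    proof -
      have "vdegree W (M1 j) v = (\<Sum>S\<in>Pow W. (if v \<in> S then M j S else 0) +
          (if S = S0 then (if j = i \<and> v \<in> S0 then 1 else 0) else 0))"
        unfolding vdegree_def by (intro sum.cong) (auto simp: M1)
      then show ?thesis using finW S0 by (simp add: sum.distrib vdegree_def)
    qed
    have "(\<Sum>S\<in>Pow W. T S - (\<Sum>i\<in>K. M1 i S)) < (\<Sum>S\<in>Pow W. T S - (\<Sum>i\<in>K. M i S))"
    proof (rule sum_strict_mono_ex1)
      show "\<exists>S\<in>Pow W. T S - (\<Sum>i\<in>K. M1 i S) < T S - (\<Sum>i\<in>K. M i S)"
        using S0 by (intro bexI[of _ S0]) (auto simp: tot)
    qed (use finW in \<open>auto simp: tot\<close>)
    then have "\<exists>M'. (\<forall>S\<in>Pow W. (\<Sum>i\<in>K. M' i S) = T S) \<and>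
      (\<forall>i\<in>K. \<forall>v\<in>W. vdegree W (M' i) v \<le> r) \<and>
      (\<forall>i S. S \<notin> Pow W \<or> (\<Sum>i\<in>K. M1 i S) = T S \<longrightarrow> M' i S = M1 i S)"
    proof (rule less.hyps)
      show "(\<Sum>i\<in>K. M1 i S) \<le> T S" if "S \<in> Pow W" for S
        using less.prems(1)[OF that] S0 by (auto simp: tot)
      show "vdegree W (M1 j) v \<le> r" if "j \<in> K" "v \<in> W" for j v
        using less.prems(2)[OF that] lt[of v] by (auto simp: deg1)
      show "S \<noteq> {} \<and> card S * D \<le> r * card K" if "S \<in> Pow W" "(\<Sum>i\<in>K. M1 i S) < T S" for S
        using less.prems(3)[OF that(1)] that(2) by (simp add: tot)
    qed
    then obtain M' where M': "\<forall>S\<in>Pow W. (\<Sum>i\<in>K. M' i S) = T S"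
      "\<forall>i\<in>K. \<forall>v\<in>W. vdegree W (M' i) v \<le> r"
      "\<And>i S. S \<notin> Pow W \<or> (\<Sum>i\<in>K. M1 i S) = T S \<Longrightarrow> M' i S = M1 i S" by blast
    have "M' j S = M j S" if "S \<notin> Pow W \<or> (\<Sum>i\<in>K. M i S) = T S" for j S
    proof -
      have "S \<noteq> S0" using that S0 by auto
      then show ?thesis using M'(3)[of S j] that by (simp add: tot M1)
    qed
    then show ?thesis using M'(1,2) by blast
  qed
qed

section \<open>Sums by size and binomial estimates\<close>

lemma sum_Pow_card:
  fixes g :: "nat \<Rightarrow> nat"
  assumes "finite A" "\<And>s. s > t \<Longrightarrow> g s = 0"
  shows "(\<Sum>S\<in>Pow A. g (card S)) = (\<Sum>s\<le>t. (card A choose s) * g s)"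
proof -
  have "(\<Sum>S\<in>Pow A. g (card S)) = (\<Sum>s\<le>card A. \<Sum>S\<in>{S\<in>Pow A. card S = s}. g (card S))"
    using assms(1) by (intro sum.group[symmetric]) (auto intro: card_mono)
  also have "\<dots> = (\<Sum>s\<le>card A. (card A choose s) * g s)"
  proof (rule sum.cong[OF refl])
    fix s
    have "(\<Sum>S\<in>{S\<in>Pow A. card S = s}. g (card S)) = card {S\<in>Pow A. card S = s} * g s" by simp
    also have "card {S\<in>Pow A. card S = s} = card A choose s"
      using n_subsets[OF assms(1), of s] by (simp add: Pow_def)
    finally show "(\<Sum>S\<in>{S\<in>Pow A. card S = s}. g (card S)) = (card A choose s) * g s" .
  qed
  also have "\<dots> = (\<Sum>s\<le>max t (card A). (card A choose s) * g s)"
    by (intro sum.mono_neutral_left) auto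
  also have "\<dots> = (\<Sum>s\<le>t. (card A choose s) * g s)"
    using assms(2) by (intro sum.mono_neutral_right) auto
  finally show ?thesis .
qed

lemma vdegree_card:
  fixes g :: "nat \<Rightarrow> nat"
  assumes "finite W" "v \<in> W" "\<And>s. s > Suc t \<Longrightarrow> g s = 0"
  shows "vdegree W (\<lambda>S. g (card S)) v = (\<Sum>s\<le>t. ((card W - 1) choose s) * g (Suc s))"
proof -
  define U where "U = W - {v}"
  have U: "W = insert v U" "finite U" "v \<notin> U" "card U = card W - 1"
    using assms by (auto simp: U_def)
  have "vdegree W (\<lambda>S. g (card S)) v = (\<Sum>S\<in>Pow U. g (Suc (card S)))"
    unfolding vdegree_def U(1) sum_Pow_insert[OF U(2,3)]
  proof (rule sum.cong[OF refl])
    fix S assume "S \<in> Pow U"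
    then have "v \<notin> S" "finite S" using U finite_subset by auto
    then show "(if v \<in> S then g (card S) else 0) +
        (if v \<in> insert v S then g (card (insert v S)) else 0) = g (Suc (card S))" by simp
  qed
  also have "\<dots> = (\<Sum>s\<le>t. (card U choose s) * g (Suc s))"
    using assms(3) by (intro sum_Pow_card[OF U(2)]) auto
  finally show ?thesis using U(4) by simp
qed

lemma Suc_times_binomial_Suc: "Suc k * (n choose Suc k) = (n - k) * (n choose k)"
  using binomial_absorption[of k n] binomial_absorb_comp[of n k] by simp

text \<open>Consecutive Vandermonde terms have the quotient
  \<open>(p - s) / (s + 1) * (4 - s) / (N - (3 - s))\<close>, and \<open>N - (3 - s)\<close> is at
  least \<open>5 * (p - s)\<close>.\<close>

lemma mixed_binomial_decay:
  assumes "s < 4" "s < p" "N \<ge> 5 * p + 5"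
  shows "5 * Suc s * ((p choose Suc s) * (N choose (3 - s))) \<le> (4 - s) * ((p choose s) * (N choose (4 - s)))"
proof -
  define k where "k = 3 - s"
  have k: "4 - s = Suc k" "3 - s = k" using assms by (auto simp: k_def)
  \<comment> \<open>The extra factor \<open>p - s\<close> lets both coefficients be rewritten by the
    same identity; it is positive and cancels at the end.\<close>
  have "(p - s) * (5 * Suc s * ((p choose Suc s) * (N choose k)))
      = 5 * (p - s) * (N choose k) * (Suc s * (p choose Suc s))" by (simp only: mult_ac)
  also have "\<dots> = 5 * (p - s) * (N choose k) * ((p - s) * (p choose s))"
    by (simp only: Suc_times_binomial_Suc)
  also have "\<dots> \<le> (N - k) * (N choose k) * ((p - s) * (p choose s))"
    using assms by (intro mult_right_mono) (auto simp: k_def)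
  also have "\<dots> = (Suc k * (N choose Suc k)) * ((p - s) * (p choose s))"
    by (simp only: Suc_times_binomial_Suc)
  also have "\<dots> = (p - s) * (Suc k * ((p choose s) * (N choose Suc k)))" by (simp only: mult_ac)
  finally show ?thesis unfolding k using assms(2) by simp
qed

text \<open>Both coefficients are products of four factors over 24. Each factor on the left is at
  most \<open>q\<close> times its partner on the right, and \<open>q ^ 4 \<le> 2\<close>.\<close>

lemma binomial_4_ratio:
  fixes n m :: nat
  assumes n: "real n \<ge> 6.285214 * real m" and m: "m > 0"
  shows "((n - 1) choose 4) \<le> 2 * ((n - m) choose 4)"
proof -
  have choose4: "real (k choose 4) * 24 = real k * (real k - 1) * (real k - 2) * (real k - 3)"
    if "k \<ge> 4" for k
    using that by (simp add: binomial_altdef_of_nat eval_nat_numeral prod.atLeast0_lessThan_Suc of_nat_diff field_simps)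
  \<comment> \<open>\<open>q\<close> is \<open>c / (c - 1)\<close> for \<open>c = 6.285214\<close>,
    because \<open>n \<ge> c * m\<close> is equivalent to
    \<open>n \<le> q * (n - m)\<close>.\<close>
  define q :: real where "q = 6285214 / 5285214"
  have q4: "q ^ 4 \<le> 2" by (simp add: q_def power_divide)
  define x where "x = real n"
  define y where "y = real n - real m"
  have m1: "real m \<ge> 1" using m by simp
  have xy: "x \<le> q * y" and y4: "y \<ge> 5"
    using n m1 by (simp_all add: x_def y_def q_def field_simps)
  have "(x - 1) * (x - 2) * (x - 3) * (x - 4) \<le> (q * y) * (q * (y - 1)) * (q * (y - 2)) * (q * (y - 3))"
  proof (intro mult_mono)
    \<comment> \<open>Besides \<open>x \<le> q * y\<close> this needs
      \<open>q * i \<le> i + 1\<close> for \<open>i\<close> up to 3, which holds as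
      \<open>q < 4 / 3\<close>.\<close>
    show "x - 1 \<le> q * y" "x - 2 \<le> q * (y - 1)" "x - 3 \<le> q * (y - 2)" "x - 4 \<le> q * (y - 3)"
      using xy by (simp_all add: q_def algebra_simps)
    have "q > 0" "x \<ge> 5" using y4 m1 by (simp_all add: q_def x_def y_def)
    then show "0 \<le> q * y" "0 \<le> q * y * (q * (y - 1))" "0 \<le> q * y * (q * (y - 1)) * (q * (y - 2))" 
      "0 \<le> x - 2" "0 \<le> x - 3" "0 \<le> x - 4"
      using y4 by auto
  qed
  also have "\<dots> = q ^ 4 * (y * (y - 1) * (y - 2) * (y - 3))"
    by (simp add: eval_nat_numeral algebra_simps)
  also have "\<dots> \<le> 2 * (y * (y - 1) * (y - 2) * (y - 3))"
    using q4 y4 by (intro mult_right_mono) auto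
  finally have main: "(x - 1) * (x - 2) * (x - 3) * (x - 4) \<le> 2 * (y * (y - 1) * (y - 2) * (y - 3))" .
  have nm: "m \<le> n" "n - m \<ge> 4" "n - 1 \<ge> 4" using y4 m1 by (auto simp: y_def)
  have "real ((n - 1) choose 4) * 24 = (x - 1) * (x - 2) * (x - 3) * (x - 4)"
    using choose4[OF nm(3)] nm by (simp add: x_def of_nat_diff)
  moreover have "real ((n - m) choose 4) * 24 = y * (y - 1) * (y - 2) * (y - 3)"
    using choose4[OF nm(2)] nm(1) by (simp add: y_def of_nat_diff)
  ultimately have "real ((n - 1) choose 4) \<le> real (2 * ((n - m) choose 4))" using main by simp
  then show ?thesis by (simp only: of_nat_le_iff)
qed

section \<open>Components of a colour class\<close>

definition class_rel :: "('a set \<Rightarrow> nat) \<Rightarrow> 'a set \<Rightarrow> ('a \<times> 'a) set" where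
  "class_rel A W = {(x, y). x \<in> W \<and> y \<in> W \<and> (x, y) \<in> (class_link A)\<^sup>*}"

lemma equiv_class_rel: "equiv W (class_rel A W)"
  by (rule equivI)
    (auto simp: class_rel_def refl_on_def sym_def trans_def intro: sym_class_link_rtrancl)

text \<open>A path starting in \<open>C\<close> cannot leave it, since each edge it uses meets
  \<open>C\<close> and is thus contained in \<open>C\<close>.\<close>

lemma quotient_class_relI:
  assumes "C \<subseteq> W" "C \<noteq> {}"
    and conn: "\<And>x y. x \<in> C \<Longrightarrow> y \<in> C \<Longrightarrow> (x, y) \<in> (class_link A)\<^sup>*"
    and closed: "\<And>S. A S > 0 \<Longrightarrow> S \<inter> C \<noteq> {} \<Longrightarrow> S \<subseteq> C"
  shows "C \<in> W // class_rel A W"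
proof -
  obtain x where x: "x \<in> C" using assms(2) by auto
  have "y \<in> C" if "(x, y) \<in> (class_link A)\<^sup>*" for y
    using that
  proof (induction rule: rtrancl_induct)
    case (step y z)
    then obtain S where "A S > 0" "y \<in> S" "z \<in> S" by (auto simp: class_link_def)
    then show ?case using closed[of S] step by auto
  qed (rule x)
  then have "C = class_rel A W `` {x}"
    using conn[OF x] x assms(1) by (auto simp: class_rel_def)
  then show ?thesis using x assms(1) by (auto intro: quotientI)
qed

text \<open>The colouring target once all edges with at least \<open>j\<close> vertices in
  \<open>W\<close> are done: their multiplicity in the amalgamated hypergraph, with \<open>N\<close>
  merged vertices, and 0 for the edges still to come.\<close>

definition mixed_mult :: "nat \<Rightarrow> nat \<Rightarrow> nat \<Rightarrow> nat \<Rightarrow> nat" where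
  "mixed_mult lam N j s = (if j \<le> s \<and> s \<le> 5 then lam * (N choose (5 - s)) else 0)"

lemma sum_atMost_4: "(\<Sum>s\<le>4. f s) = f 0 + f 1 + f 2 + f 3 + f (4::nat)" for f :: "nat \<Rightarrow> nat"
  by (simp add: eval_nat_numeral)

lemma vdegree_mixed_mult:
  assumes "finite W" "v \<in> W"
  shows "vdegree W (\<lambda>S. mixed_mult lam N j (card S)) v =
    lam * (\<Sum>s\<le>4. if j \<le> Suc s then ((card W - 1) choose s) * (N choose (4 - s)) else 0)"
  by (subst vdegree_card[OF assms, of 4]) (auto simp: mixed_mult_def sum_distrib_left intro!: sum.cong)

text \<open>Three greedy rounds, for \<open>j = 4, 3, 2\<close> vertices in \<open>W\<close>. The
  room condition says that \<open>j\<close> times the number of edges at a vertex with at least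
  \<open>j\<close> vertices in \<open>W\<close> is at most the full degree. Decay suffices for
  \<open>j = 4\<close> and \<open>j = 3\<close>; for \<open>j = 2\<close> the condition is precisely
  the hypothesis \<open>ratio\<close>.\<close>

lemma colour_mixed_edges:
  fixes M0 :: "nat \<Rightarrow> 'a set \<Rightarrow> nat"
  assumes finK: "finite K" and finW: "finite W" and m: "card W > 5"
    and n: "6 * card W \<le> n" and ratio: "((n - 1) choose 4) \<le> 2 * ((n - card W) choose 4)"
    and K: "r * card K = lam * ((n - 1) choose 4)"
    and tot: "\<And>S. S \<in> Pow W \<Longrightarrow> (\<Sum>i\<in>K. M0 i S) = (if card S = 5 then lam else 0)"
    and deg: "\<And>i v. i \<in> K \<Longrightarrow> v \<in> W \<Longrightarrow> vdegree W (M0 i) v \<le> r"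
  obtains M where
    "\<And>S. S \<in> Pow W \<Longrightarrow> (\<Sum>i\<in>K. M i S) = mixed_mult lam (n - card W) 2 (card S)"
    "\<And>i v. i \<in> K \<Longrightarrow> v \<in> W \<Longrightarrow> vdegree W (M i) v \<le> r"
    "\<And>i S. S \<notin> Pow W \<or> card S = 5 \<Longrightarrow> M i S = M0 i S"
proof -
  define N where "N = n - card W"
  define p where "p = card W - 1"
  \<comment> \<open>Through a vertex of \<open>W\<close> there are \<open>lam * a s\<close> edges
    with exactly \<open>s\<close> further vertices in \<open>W\<close>.\<close>
  define a where "a s = (p choose s) * (N choose (4 - s))" for s
  have p: "p \<ge> 5" "N \<ge> 5 * p + 5" "p + N = n - 1" using m n by (auto simp: p_def N_def)
  have vander: "a 0 + a 1 + a 2 + a 3 + a 4 = ((n - 1) choose 4)"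
    using vandermonde[of p N 4] p(3) by (simp add: sum_atMost_4 a_def)
  have decay: "10 * a 2 \<le> 3 * a 1" "15 * a 3 \<le> 2 * a 2" "20 * a 4 \<le> a 3" "5 * a 1 \<le> 4 * a 0"
    using mixed_binomial_decay[of 1 p N] mixed_binomial_decay[of 2 p N]
      mixed_binomial_decay[of 3 p N] mixed_binomial_decay[of 0 p N] p
    by (simp_all add: a_def eval_nat_numeral)
  have a0: "a 0 = (N choose 4)" by (simp add: a_def)
  define D where "D j = lam * (\<Sum>s\<le>4. if j \<le> Suc s then a s else 0)" for j
  have room: "j * D j \<le> r * card K" if "j \<in> {2, 3, 4}" for j
  proof -
    have "j * (\<Sum>s\<le>4. if j \<le> Suc s then a s else 0) \<le> a 0 + a 1 + a 2 + a 3 + a 4"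
      using that decay vander ratio a0 unfolding sum_atMost_4 N_def[symmetric] by auto
    then have "lam * (j * (\<Sum>s\<le>4. if j \<le> Suc s then a s else 0)) \<le> lam * ((n - 1) choose 4)"
      unfolding vander by (rule mult_left_mono) simp
    then show ?thesis unfolding K D_def by (simp only: mult_ac)
  qed
  \<comment> \<open>After \<open>k\<close> rounds the sizes from \<open>5 - k\<close> upwards are
    coloured; \<open>k = 0\<close> is the given colouring.\<close>
  have "\<exists>M. (\<forall>S\<in>Pow W. (\<Sum>i\<in>K. M i S) = mixed_mult lam N (5 - k) (card S)) \<and>
       (\<forall>i\<in>K. \<forall>v\<in>W. vdegree W (M i) v \<le> r) \<and>
       (\<forall>i S. S \<notin> Pow W \<or> card S = 5 \<longrightarrow> M i S = M0 i S)" if "k \<le> 3" for k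
    using that
  proof (induction k)
    case 0
    show ?case using tot deg by (intro exI[of _ M0]) (auto simp: mixed_mult_def)
  next
    case (Suc k)
    define j where "j = 5 - Suc k"
    have j: "j \<in> {2, 3, 4}" "5 - k = Suc j" using Suc.prems by (auto simp: j_def)
    obtain M where M: "\<forall>S\<in>Pow W. (\<Sum>i\<in>K. M i S) = mixed_mult lam N (Suc j) (card S)"
       "\<forall>i\<in>K. \<forall>v\<in>W. vdegree W (M i) v \<le> r"
       "\<forall>i S. S \<notin> Pow W \<or> card S = 5 \<longrightarrow> M i S = M0 i S"
      using Suc unfolding j(2) by auto
    have "\<exists>M'. (\<forall>S\<in>Pow W. (\<Sum>i\<in>K. M' i S) = mixed_mult lam N j (card S)) \<and>
      (\<forall>i\<in>K. \<forall>v\<in>W. vdegree W (M' i) v \<le> r) \<and>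
      (\<forall>i S. S \<notin> Pow W \<or> (\<Sum>i\<in>K. M i S) = mixed_mult lam N j (card S) \<longrightarrow> M' i S = M i S)"
    proof (rule greedy_colouring[OF finK finW, where D = "D j"])
      show "(\<Sum>i\<in>K. M i S) \<le> mixed_mult lam N j (card S)" if "S \<in> Pow W" for S
        using M(1) that by (auto simp: mixed_mult_def)
      show "vdegree W (M i) v \<le> r" if "i \<in> K" "v \<in> W" for i v using M(2) that by blast
      show "vdegree W (\<lambda>S. mixed_mult lam N j (card S)) v \<le> D j" if "v \<in> W" for v
        unfolding vdegree_mixed_mult[OF finW that] D_def a_def p_def by (rule order_refl)
      show "S \<noteq> {} \<and> card S * D j \<le> r * card K"
        if "S \<in> Pow W" "(\<Sum>i\<in>K. M i S) < mixed_mult lam N j (card S)" for S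
      proof -
        have "card S = j" using M(1) that by (auto simp: mixed_mult_def split: if_splits)
        then show ?thesis using room[OF j(1)] j(1) by auto
      qed
    qed
    then obtain M' where M': "\<forall>S\<in>Pow W. (\<Sum>i\<in>K. M' i S) = mixed_mult lam N j (card S)"
      "\<forall>i\<in>K. \<forall>v\<in>W. vdegree W (M' i) v \<le> r"
      "\<forall>i S. S \<notin> Pow W \<or> (\<Sum>i\<in>K. M i S) = mixed_mult lam N j (card S) \<longrightarrow> M' i S = M i S"
      by blast
    have "M' i S = M0 i S" if "S \<notin> Pow W \<or> card S = 5" for i S
    proof -
      have "S \<notin> Pow W \<or> (\<Sum>i\<in>K. M i S) = mixed_mult lam N j (card S)"
        using that M(1) j by (auto simp: mixed_mult_def)
      then show ?thesis using M'(3) M(3) that by metis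
    qed
    then show ?case using M'(1,2) unfolding j_def by blast
  qed
  from this[of 3] show ?thesis using that by (auto simp: N_def)
qed

text \<open>Once the mixed edges are coloured, degree \<open>r\<close> forces the multiplicities of
  the single vertices, and the number of edges of an \<open>r\<close>-factor forces that of
  \<open>{}\<close>. That their totals over the colours are right follows from Vandermonde's
  identity.\<close>

theorem initial_stage:
  fixes M0 :: "nat \<Rightarrow> 'a set \<Rightarrow> nat"
  assumes finK: "finite K" and finW: "finite W" and m: "card W > 5"
    and n: "6 * card W \<le> n" and ratio: "((n - 1) choose 4) \<le> 2 * ((n - card W) choose 4)"
    and r: "r > 0" and lam: "lam > 0" and dvd: "5 dvd r * n"
    and K: "r * card K = lam * ((n - 1) choose 4)"
    and tot: "\<And>S. S \<in> Pow W \<Longrightarrow> (\<Sum>i\<in>K. M0 i S) = (if card S = 5 then lam else 0)"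
    and supp: "\<And>i S. i \<in> K \<Longrightarrow> S \<notin> Pow W \<Longrightarrow> M0 i S = 0"
    and deg: "\<And>i v. i \<in> K \<Longrightarrow> v \<in> W \<Longrightarrow> vdegree W (M0 i) v \<le> r"
    and nonreg: "\<And>i C. i \<in> K \<Longrightarrow> C \<in> W // class_rel (M0 i) W \<Longrightarrow> \<exists>v\<in>C. vdegree W (M0 i) v \<noteq> r"
  shows "\<exists>M. stage 5 r n lam K W M \<and> (\<forall>i\<in>K. \<forall>S. S \<subseteq> W \<longrightarrow> card S = 5 \<longrightarrow> M i S = M0 i S)"
proof -
  have M0_0: "M0 i S = 0" if "i \<in> K" "card S \<noteq> 5" for i S
    using tot[of S] supp[of i S] that finK by (cases "S \<in> Pow W") auto
  \<comment> \<open>For \<open>r = 1\<close> a coloured edge inside \<open>W\<close> meets no other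
    edge of its class and would itself be an \<open>r\<close>-regular component.\<close>
  have r2: "r \<ge> 2"
  proof (rule ccontr)
    assume "\<not> r \<ge> 2"
    then have r1: "r = 1" using r by simp
    obtain S where S: "S \<subseteq> W" "card S = 5"
      using m by (meson less_imp_le obtain_subset_with_card_n)
    then have "(\<Sum>i\<in>K. M0 i S) \<noteq> 0" using tot[of S] lam by simp
    then obtain i where i: "i \<in> K" "M0 i S > 0" using finK by auto
    have uniq: "S' = S" if "M0 i S' > 0" "S' \<inter> S \<noteq> {}" for S'
    proof (rule ccontr)
      assume ne: "S' \<noteq> S"
      obtain v where v: "v \<in> S" "v \<in> S'" using \<open>S' \<inter> S \<noteq> {}\<close> by blast
      have "S' \<subseteq> W" using supp[OF i(1), of S'] that by fastforce
      have "M0 i S + M0 i S' = (\<Sum>T\<in>{S, S'}. if v \<in> T then M0 i T else 0)" using ne v by simp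
      also have "\<dots> \<le> vdegree W (M0 i) v"
        unfolding vdegree_def using finW S \<open>S' \<subseteq> W\<close> by (intro sum_mono2) auto
      also have "\<dots> \<le> 1" using deg[OF i(1), of v] v S r1 by auto
      finally show False using that i by linarith
    qed
    have "S \<in> W // class_rel (M0 i) W"
    proof (rule quotient_class_relI)
      show "S \<noteq> {}" using S by auto
      show "(x, y) \<in> (class_link (M0 i))\<^sup>*" if "x \<in> S" "y \<in> S" for x y
        using that i by (intro r_into_rtrancl) (auto simp: class_link_def)
    qed (use S uniq in auto)
    then obtain v where v: "v \<in> S" "vdegree W (M0 i) v \<noteq> r" using nonreg i(1) by blast
    have "(\<Sum>T\<in>{S}. if v \<in> T then M0 i T else 0) \<le> vdegree W (M0 i) v"
      unfolding vdegree_def using finW S by (intro sum_mono2) auto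
    then show False using deg[OF i(1), of v] v S r1 i by auto
  qed
  define N where "N = n - card W"
  \<comment> \<open>\<open>e\<close> is the number of edges of an \<open>r\<close>-factor on
    \<open>n\<close> vertices; admissibility makes the division exact.\<close>
  define e where "e = r * n div 5"
  have e: "r * n = 5 * e" using dvd by (simp add: e_def)
  obtain M3 where M3: "\<And>S. S \<in> Pow W \<Longrightarrow> (\<Sum>i\<in>K. M3 i S) = mixed_mult lam N 2 (card S)"
    "\<And>i v. i \<in> K \<Longrightarrow> v \<in> W \<Longrightarrow> vdegree W (M3 i) v \<le> r"
    "\<And>i S. S \<notin> Pow W \<or> card S = 5 \<Longrightarrow> M3 i S = M0 i S"
    using colour_mixed_edges[OF finK finW m n ratio K tot deg] unfolding N_def by blast
  have M3_0: "M3 i S = 0" if "i \<in> K" "card S < 2 \<or> card S > 5 \<or> S \<notin> Pow W" for i S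
  proof (cases "S \<in> Pow W")
    case True
    then have "(\<Sum>i\<in>K. M3 i S) = 0" using M3(1)[OF True] that(2) by (auto simp: mixed_mult_def)
    then show ?thesis using finK that(1) by simp
  qed (use M3(3) supp that in auto)
  define M' where "M' i S = (if card S = 1 \<and> S \<subseteq> W then r - vdegree W (M3 i) (the_elem S) else M3 i S)" for i S
  define M where "M i S = (if S = {} then e - (\<Sum>T\<in>Pow W - {{}}. M' i T) else M' i S)" for i S
  have M_ge2: "M i S = M3 i S" if "card S \<ge> 2" for i S
    using that by (auto simp: M_def M'_def)
  have M_single: "M i {v} = r - vdegree W (M3 i) v" if "v \<in> W" for i v
    using that by (simp add: M_def M'_def)
  have degM: "vdegree W (M i) v = r" if i: "i \<in> K" and v: "v \<in> W" for i v
  proof -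
    have "vdegree W (M i) v = (\<Sum>S\<in>Pow W. (if v \<in> S then M3 i S else 0) + 
        (if S = {v} then r - vdegree W (M3 i) v else 0))"
      unfolding vdegree_def[of W "M i"]
    proof (rule sum.cong[OF refl])
      fix S assume "S \<in> Pow W"
      then have fS: "finite S" using finW finite_subset by blast
      show "(if v \<in> S then M i S else 0) =
        (if v \<in> S then M3 i S else 0) + (if S = {v} then r - vdegree W (M3 i) v else 0)"
      proof (cases "v \<in> S \<and> S \<noteq> {v}")
        case True
        then have "card S \<ge> 2"
          using fS by (metis One_nat_def Suc_1 Suc_leI card_1_singletonE card_gt_0_iff empty_iff le_neq_implies_less singletonD)
        then show ?thesis using True by (simp add: M_ge2)
      next
        case False
        then consider "v \<notin> S" "S \<noteq> {v}" | "S = {v}" by blast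
        then show ?thesis
        proof cases
          case 2
          then show ?thesis using M_single[OF v, of i] M3_0[OF i, of "{v}"] by simp
        qed simp
      qed
    qed
    also have "\<dots> = vdegree W (M3 i) v + (r - vdegree W (M3 i) v)"
      using finW v by (simp add: sum.distrib vdegree_def)
    finally show ?thesis using M3(2)[OF i v] by simp
  qed
  have suppM: "S \<subseteq> W \<and> card S \<le> 5" if "M i S > 0" "i \<in> K" for i S
  proof (cases "S = {} \<or> card S = 1 \<and> S \<subseteq> W")
    case False
    then have "M3 i S > 0" using that(1) by (simp add: M_def M'_def split: if_splits)
    then show ?thesis using M3_0[OF that(2), of S] by force
  qed auto
  have sizes: "(\<Sum>S\<in>Pow W. card S * M i S) = r * card W" if "i \<in> K" for i
    using degM[OF that] sum_vdegree[OF finW, of "M i"] by (simp add: mult.commute)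
  have count: "(\<Sum>S\<in>Pow W. M i S) = e" if i: "i \<in> K" for i
  proof -
    \<comment> \<open>The subtraction in \<open>M i {}\<close> must not be truncated: every edge
      counted here has an end in \<open>W\<close>, and there are \<open>r * card W\<close> such
      ends, at most \<open>e\<close> since \<open>5 * card W \<le> n\<close>.\<close>
    have "(\<Sum>T\<in>Pow W - {{}}. M' i T) = (\<Sum>T\<in>Pow W - {{}}. M i T)"
      by (intro sum.cong) (auto simp: M_def)
    also have "\<dots> \<le> (\<Sum>T\<in>Pow W - {{}}. card T * M i T)"
    proof (rule sum_mono)
      fix T assume "T \<in> Pow W - {{}}"
      then have "card T \<ge> 1" using finW finite_subset by (metis DiffE PowD Suc_leI card_gt_0_iff insertI1 One_nat_def)
      then show "M i T \<le> card T * M i T" by (cases "card T") auto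
    qed
    also have "\<dots> \<le> (\<Sum>T\<in>Pow W. card T * M i T)" using finW by (intro sum_mono2) auto
    also have "\<dots> = r * card W" by (rule sizes[OF i])
    also have "\<dots> \<le> e"
    proof -
      have "r * (5 * card W) \<le> r * n" using n by (intro mult_left_mono) auto
      then show ?thesis using e by simp
    qed
    finally have le: "(\<Sum>T\<in>Pow W - {{}}. M' i T) \<le> e" .
    have "(\<Sum>S\<in>Pow W. M i S) = M i {} + (\<Sum>S\<in>Pow W - {{}}. M i S)"
      using finW by (intro sum.remove) auto
    also have "(\<Sum>S\<in>Pow W - {{}}. M i S) = (\<Sum>S\<in>Pow W - {{}}. M' i S)"
      by (intro sum.cong) (auto simp: M_def)
    finally show ?thesis using le by (simp add: M_def)
  qed
  have total: "(\<Sum>S\<in>Pow W. (5 - card S) * M i S) = r * N" if i: "i \<in> K" for i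
  proof -
    have "(\<Sum>S\<in>Pow W. (5 - card S) * M i S) + (\<Sum>S\<in>Pow W. card S * M i S) = (\<Sum>S\<in>Pow W. 5 * M i S)"
      unfolding sum.distrib[symmetric]
    proof (rule sum.cong[OF refl])
      fix S
      show "(5 - card S) * M i S + card S * M i S = 5 * M i S"
        using suppM[of i S] i by (cases "M i S = 0") (auto simp flip: add_mult_distrib)
    qed
    also have "\<dots> = r * n" using count[OF i] e by (simp flip: sum_distrib_left)
    finally show ?thesis unfolding sizes[OF i] by (simp add: N_def diff_mult_distrib2)
  qed
  have col: "(\<Sum>i\<in>K. M i S) = lam * (N choose (5 - card S))" if S: "S \<in> Pow W" "card S \<le> 5" "S \<noteq> {}" for S
  proof (cases "card S \<ge> 2")
    case True
    then show ?thesis using S M3(1)[OF S(1)] by (simp add: M_ge2 mixed_mult_def)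
  next
    case False
    have "finite S" using S finW finite_subset by blast
    then have "card S = 1" using False S by (metis One_nat_def Suc_1 Suc_leI card_gt_0_iff linorder_not_less order_antisym)
    then obtain v where v: "S = {v}" "v \<in> W" using S by (auto simp: card_1_singleton_iff)
    \<comment> \<open>All colours together offer degree
      \<open>r * card K = lam * (a 0 + a 1 + a 2 + a 3 + a 4)\<close> at \<open>v\<close>, of which
      the mixed edges use all but the term \<open>a 0\<close>.\<close>
    define a where "a s = ((card W - 1) choose s) * (N choose (4 - s))" for s
    have "(\<Sum>i\<in>K. M i S) = (\<Sum>i\<in>K. r - vdegree W (M3 i) v)" using v by (simp add: M_single)
    also have "\<dots> = r * card K - (\<Sum>i\<in>K. vdegree W (M3 i) v)"
      using M3(2) v by (subst sum_subtractf_nat) (auto simp: mult.commute)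
    also have "(\<Sum>i\<in>K. vdegree W (M3 i) v) = vdegree W (\<lambda>S. mixed_mult lam N 2 (card S)) v"
      unfolding vdegree_sum unfolding vdegree_def using M3(1) by (intro sum.cong) auto
    also have "\<dots> = lam * (a 1 + a 2 + a 3 + a 4)"
      unfolding vdegree_mixed_mult[OF finW v(2)] by (simp add: sum_atMost_4 a_def)
    also have "r * card K = lam * (a 0 + (a 1 + a 2 + a 3 + a 4))"
    proof -
      have "card W - 1 + N = n - 1" using m n by (simp add: N_def)
      then show ?thesis
        using vandermonde[of "card W - 1" N 4] K by (simp add: sum_atMost_4 a_def)
    qed
    finally show ?thesis using v by (simp add: a_def add_mult_distrib2)
  qed
  have col0: "(\<Sum>i\<in>K. M i {}) = lam * (N choose 5)"
  proof -
    \<comment> \<open>All edges are counted twice, as \<open>card K * e\<close> and by their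
      intersections with \<open>W\<close>. The counts agree on nonempty sets by \<open>col\<close>,
      which leaves the right number for \<open>{}\<close>.\<close>
    define g where "g s = (if s \<le> 5 then lam * (N choose (5 - s)) else 0)" for s
    have colg: "(\<Sum>i\<in>K. M i S) = g (card S)" if "S \<in> Pow W - {{}}" for S
    proof (cases "card S \<le> 5")
      case False
      then have "M i S = 0" if "i \<in> K" for i using suppM[of i S] that by auto
      then show ?thesis using False by (simp add: g_def)
    qed (use that col[of S] in \<open>auto simp: g_def\<close>)
    have "(\<Sum>S\<in>Pow W. g (card S)) = (\<Sum>s\<le>5. (card W choose s) * g s)"
      by (rule sum_Pow_card[OF finW]) (simp add: g_def)
    also have "\<dots> = lam * (\<Sum>s\<le>5. (card W choose s) * (N choose (5 - s)))"
      unfolding sum_distrib_left by (intro sum.cong) (auto simp: g_def)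
    also have "\<dots> = lam * (n choose 5)"
    proof -
      have "card W + N = n" using n by (simp add: N_def)
      then show ?thesis using vandermonde[of "card W" N 5] by simp
    qed
    also have "\<dots> = card K * e"
    proof -
      have "5 * (card K * e) = lam * (n * ((n - 1) choose 4))"
        using e K by (metis mult.assoc mult.commute)
      also have "n * ((n - 1) choose 4) = 5 * (n choose 5)"
        using times_binomial_minus1_eq[of 5 n] by simp
      finally show ?thesis by simp
    qed
    also have "\<dots> = (\<Sum>i\<in>K. \<Sum>S\<in>Pow W. M i S)" by (simp add: count)
    also have "\<dots> = (\<Sum>S\<in>Pow W. \<Sum>i\<in>K. M i S)" by (rule sum.swap)
    also have "\<dots> = (\<Sum>i\<in>K. M i {}) + (\<Sum>S\<in>Pow W - {{}}. \<Sum>i\<in>K. M i S)"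
      using finW by (intro sum.remove) auto
    also have "(\<Sum>S\<in>Pow W - {{}}. \<Sum>i\<in>K. M i S) = (\<Sum>S\<in>Pow W - {{}}. g (card S))"
      by (intro sum.cong colg) auto
    finally have "(\<Sum>S\<in>Pow W. g (card S)) = (\<Sum>i\<in>K. M i {}) + (\<Sum>S\<in>Pow W - {{}}. g (card S))" .
    moreover have "(\<Sum>S\<in>Pow W. g (card S)) = g (card ({}::'a set)) + (\<Sum>S\<in>Pow W - {{}}. g (card S))"
      using finW by (intro sum.remove) auto
    ultimately show ?thesis by (simp add: g_def)
  qed
  have agree: "M i S = M0 i S" if "card S = 5" for i S
    using that M3(3) by (simp add: M_ge2)
  have state: "class_state 5 r n W (M i) (W // class_rel (M i) W)" if i: "i \<in> K" for i
  proof -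
    define P where "P = W // class_rel (M i) W"
    have part: "partition_on W P" unfolding P_def by (rule partition_on_quotient[OF equiv_class_rel])
    have finP: "finite P" using finite_elements[OF finW part] .
    have P_class: "(x, y) \<in> class_rel (M i) W" if "C \<in> P" "x \<in> C" "y \<in> C" for C x y
      using quotient_eq_iff[OF equiv_class_rel, of C W "M i" C x y] that by (simp add: P_def)
    have closed: "S \<subseteq> C" if "M i S > 0" "C \<in> P" "S \<inter> C \<noteq> {}" for S C
    proof
      fix y assume y: "y \<in> S"
      obtain x where x: "x \<in> S" "x \<in> C" using \<open>S \<inter> C \<noteq> {}\<close> by blast
      have "S \<subseteq> W" using suppM that(1) i by blast
      then have "(x, y) \<in> class_rel (M i) W"
        using x y that(1) by (auto simp: class_rel_def class_link_def)
      with equiv_class_rel \<open>C \<in> P\<close>[unfolded P_def] x(2) show "y \<in> C"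
        by (rule in_quotient_imp_closed)
    qed
    have hinged: "hinges 5 (M i) C > 0" if C: "C \<in> P" for C
    proof (rule ccontr)
      \<comment> \<open>Without hinges all edges meeting \<open>C\<close> have five vertices in
        \<open>W\<close>, hence come from \<open>M0\<close>. So \<open>C\<close> is a component of
        the given class and already has degree \<open>r\<close> everywhere, against
        \<open>nonreg\<close>.\<close>
      assume "\<not> ?thesis"
      moreover have CW: "C \<subseteq> W" using part C by (auto simp: partition_on_def)
      moreover have "finite C" using finite_subset[OF CW finW] .
      ultimately have h0: "(5 - card S) * M i S = 0" if "S \<in> Pow C - {{}}" for S
        using that by (simp add: hinges_def del: mult_eq_0_iff)
      have five: "card S = 5" if "M i S > 0" "S \<inter> C \<noteq> {}" for S
      proof -
        have "S \<in> Pow C - {{}}" using closed[OF that(1) C that(2)] that(2) by blast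
        then show ?thesis using h0[of S] that(1) suppM[OF that(1) i] by auto
      qed
      have eqM: "M i S = M0 i S" if "S \<inter> C \<noteq> {}" for S
        using agree[of S i] five[of S] M0_0[OF i, of S] that by (cases "card S = 5") auto
      have "C \<in> W // class_rel (M0 i) W"
      proof (rule quotient_class_relI[OF CW])
        show "C \<noteq> {}" using part C by (auto simp: partition_on_def)
        show "S \<subseteq> C" if "M0 i S > 0" "S \<inter> C \<noteq> {}" for S
          using closed[of S C] eqM[of S] that C by simp
        show "(x, y) \<in> (class_link (M0 i))\<^sup>*" if x: "x \<in> C" and "y \<in> C" for x y
        proof -
          have "(x, y) \<in> (class_link (M i))\<^sup>*" using P_class[OF C that] by (simp add: class_rel_def)
          then have "(x, y) \<in> (class_link (M0 i))\<^sup>* \<and> y \<in> C"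
          proof (induction rule: rtrancl_induct)
            case (step y z)
            then obtain S where S: "M i S > 0" "y \<in> S" "z \<in> S" by (auto simp: class_link_def)
            then have "S \<inter> C \<noteq> {}" using step by auto
            then have "M0 i S > 0" "z \<in> C" using eqM[of S] S closed[OF S(1) C] by auto
            then have "(y, z) \<in> class_link (M0 i)" using S by (auto simp: class_link_def)
            then show ?case using step \<open>z \<in> C\<close> by (meson rtrancl_into_rtrancl)
          qed (use x in simp)
          then show ?thesis ..
        qed
      qed
      then obtain v where v: "v \<in> C" "vdegree W (M0 i) v \<noteq> r" using nonreg[OF i] by blast
      have "vdegree W (M0 i) v = vdegree W (M i) v"
      proof -
        have "M i S = M0 i S" if "v \<in> S" for S using eqM[of S] that v(1) by blast
        then show ?thesis unfolding vdegree_def by (intro sum.cong) auto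
      qed
      then show False using v degM[OF i, of v] CW by auto
    qed
    have refines: "\<exists>C\<in>P. S \<subseteq> C" if "M i S > 0" "S \<noteq> {}" for S
    proof -
      obtain x where x: "x \<in> S" using \<open>S \<noteq> {}\<close> by blast
      then have "x \<in> W" using suppM[OF that(1) i] by blast
      then obtain C where "C \<in> P" "x \<in> C" using part by (auto simp: partition_on_def)
      then show ?thesis using closed[OF that(1)] x by blast
    qed
    have "card P \<le> card W"
    proof -
      have "P = (\<lambda>x. class_rel (M i) W `` {x}) ` W" unfolding P_def quotient_def by auto
      then show ?thesis using card_image_le[OF finW] by metis
    qed
    moreover have "r * N = 5 * M i {} + (\<Sum>C\<in>P. hinges 5 (M i) C)"
    proof -
      have "r * N = (5 - card ({}::'a set)) * M i {} + (\<Sum>C\<in>P. \<Sum>S\<in>Pow C - {{}}. (5 - card S) * M i S)"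
        unfolding total[OF i, symmetric]
        by (rule sum_Pow_partition[OF finW part]) (use refines in auto)
      then show ?thesis by (simp add: hinges_def)
    qed
    moreover have "card P \<le> (\<Sum>C\<in>P. hinges 5 (M i) C)"
    proof -
      have "(\<Sum>C\<in>P. 1) \<le> (\<Sum>C\<in>P. hinges 5 (M i) C)" by (rule sum_mono) (use hinged in force)
      then show ?thesis by simp
    qed
    \<comment> \<open>Of \<open>5 * card P\<close>, four copies are bounded by \<open>card W\<close>
      and one by the hinges of the parts. It remains that \<open>4 * card W \<le> N\<close> and
      \<open>1 + r \<le> 5 * (r - 1)\<close>, where \<open>r \<ge> 2\<close> enters.\<close>
    ultimately have "5 * (card P + M i {}) \<le> 4 * card W + r * N"
      unfolding distrib_left by linarith
    also have "\<dots> \<le> N + r * N" using n by (simp add: N_def)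
    also have "\<dots> \<le> 5 * ((r - 1) * N)"
    proof -
      obtain r' where "r = r' + 2" using r2 by (metis add.commute le_Suc_ex)
      then show ?thesis by (simp add: algebra_simps)
    qed
    finally have few: "card P + M i {} \<le> (r - 1) * N + 1" by simp
    have "class_state 5 r n W (M i) P"
    proof
      show "(2::nat) \<le> 5" "1 \<le> r" "finite W" "card W \<le> n" using r n finW by auto
      show "S \<subseteq> W \<and> card S \<le> 5" if "M i S > 0" for S using suppM[OF that i] .
      show "(\<Sum>S\<in>Pow W. if v \<in> S then M i S else 0) = r" if "v \<in> W" for v
        using degM[OF i that] by (simp add: vdegree_def)
      show "(\<Sum>S\<in>Pow W. (5 - card S) * M i S) = r * (n - card W)" using total[OF i] by (simp add: N_def)
      show "partition_on W P" by (rule part)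
      show "\<exists>C\<in>P. S \<subseteq> C" if "M i S > 0" "S \<noteq> {}" for S using refines[OF that] .
      show "(x, y) \<in> (class_link (M i))\<^sup>*" if "C \<in> P" "x \<in> C" "y \<in> C" for C x y
        using P_class[OF that] by (simp add: class_rel_def)
      show "hinges 5 (M i) C > 0" if "C \<in> P" for C using hinged[OF that] .
      show "card P + M i {} \<le> (r - 1) * (n - card W) + 1" using few by (simp add: N_def)
    qed
    then show ?thesis by (simp only: P_def)
  qed
  have "stage 5 r n lam K W M"
    unfolding stage_def
  proof (intro conjI ballI impI)
    show "\<exists>P. class_state 5 r n W (M i) P" if "i \<in> K" for i using state[OF that] by blast
    show "(\<Sum>i\<in>K. M i S) = lam * ((n - card W) choose (5 - card S))" if "S \<in> Pow W" "card S \<le> 5" for S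
      using col[OF that] col0 by (cases "S = {}") (auto simp: N_def)
  qed
  then show ?thesis using agree by blast
qed

section \<open>Hypergraphs and multiplicity functions\<close>

lemma equiv_linked: "equiv (verts F) (linked F)"
proof (rule equivI)
  define R where "R = {(x, y). \<exists>e\<in>edges F. x \<in> fst e \<and> y \<in> fst e}"
  have "sym (R\<^sup>*)" by (intro sym_rtrancl) (auto simp: R_def sym_def)
  then show "sym (linked F)" by (auto simp: linked_def R_def[symmetric] sym_def)
  show "trans (linked F)" by (auto simp: linked_def trans_def intro: rtrancl_trans)
qed (auto simp: linked_def refl_on_def)

lemma edge_in_component:
  assumes "D \<in> verts F // linked F" "e \<in> edges F" "fst e \<subseteq> verts F" "v \<in> D" "v \<in> fst e"
  shows "fst e \<subseteq> D"
proof
  fix w assume "w \<in> fst e"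
  then have "(v, w) \<in> linked F" using assms by (auto simp: linked_def)
  with equiv_linked assms(1,4) show "w \<in> D" by (rule in_quotient_imp_closed)
qed

lemma degree_component:
  assumes "D \<in> verts F // linked F" "\<And>e. e \<in> edges F \<Longrightarrow> fst e \<subseteq> verts F" "v \<in> D"
  shows "degree (induced_hypergraph F D) v = degree F v"
proof -
  have "{e \<in> edges (induced_hypergraph F D). v \<in> fst e} = {e \<in> edges F. v \<in> fst e}"
    using edge_in_component[OF assms(1)] assms(2,3) by (auto simp: induced_hypergraph_def)
  then show ?thesis by (simp add: degree_def)
qed

lemma induced_complete_hypergraph:
  "W \<subseteq> V \<Longrightarrow> induced_hypergraph (complete_hypergraph lam h V) W = complete_hypergraph lam h W"
  by (auto simp: induced_hypergraph_def complete_hypergraph_def)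

definition edge_mult :: "nat \<Rightarrow> nat \<Rightarrow> 'a set \<Rightarrow> ('a set \<times> nat \<Rightarrow> nat) \<Rightarrow> nat \<Rightarrow> 'a set \<Rightarrow> nat" where
  "edge_mult lam h V c i S = (if S \<subseteq> V \<and> card S = h then card {j\<in>{..<lam}. c (S, j) = i} else 0)"

lemma degree_color_class:
  assumes "finite V"
  shows "degree (color_class (complete_hypergraph lam h V) c i) v = vdegree V (edge_mult lam h V c i) v"
proof -
  define \<S> where "\<S> = {S\<in>Pow V. v \<in> S \<and> card S = h}"
  have "{e \<in> edges (color_class (complete_hypergraph lam h V) c i). v \<in> fst e} =
      (SIGMA S:\<S>. {j\<in>{..<lam}. c (S, j) = i})"
    by (auto simp: color_class_def complete_hypergraph_def \<S>_def)
  then have "degree (color_class (complete_hypergraph lam h V) c i) v =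
      (\<Sum>S\<in>\<S>. card {j\<in>{..<lam}. c (S, j) = i})"
    unfolding degree_def using assms by (subst card_SigmaI[symmetric]) (auto simp: \<S>_def)
  also have "\<dots> = vdegree V (edge_mult lam h V c i) v"
    unfolding vdegree_def using assms
    by (intro sum.mono_neutral_cong_left) (auto simp: \<S>_def edge_mult_def)
  finally show ?thesis .
qed

lemma linked_color_class:
  "linked (color_class (complete_hypergraph lam h V) c i) = class_rel (edge_mult lam h V c i) V"
proof -
  have "{(x, y). \<exists>e \<in> edges (color_class (complete_hypergraph lam h V) c i). x \<in> fst e \<and> y \<in> fst e} =
      class_link (edge_mult lam h V c i)"
    by (auto simp: class_link_def edge_mult_def color_class_def complete_hypergraph_def card_gt_0_iff)
  then show ?thesis
    by (simp add: linked_def class_rel_def color_class_def complete_hypergraph_def)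
qed

lemma sum_edge_mult:
  assumes "finite K" "edge_coloring (complete_hypergraph lam h V) K c" "S \<in> Pow V"
  shows "(\<Sum>i\<in>K. edge_mult lam h V c i S) = (if card S = h then lam else 0)"
proof (cases "card S = h")
  case True
  have "c (S, j) \<in> K" if "j < lam" for j
    using assms(2,3) True that by (auto simp: edge_coloring_def complete_hypergraph_def)
  then have "(\<Sum>i\<in>K. \<Sum>j\<in>{j\<in>{..<lam}. c (S, j) = i}. 1) = (\<Sum>j<lam. 1::nat)"
    using assms(1) by (intro sum.group) auto
  then show ?thesis using True assms(3) by (simp add: edge_mult_def)
qed (simp add: edge_mult_def)

text \<open>Labels are dealt out in consecutive blocks, one of length \<open>a i\<close> for each
  \<open>i\<close>. This turns multiplicities back into colours of parallel edges.\<close>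

lemma exists_function_with_fibres:
  fixes a :: "'b \<Rightarrow> nat"
  assumes "finite K" "(\<Sum>i\<in>K. a i) = t"
  shows "\<exists>f. (\<forall>j<t. f j \<in> K) \<and> (\<forall>i\<in>K. card {j\<in>{..<t}. f j = i} = a i)"
  using assms
proof (induction K arbitrary: t rule: finite_induct)
  case (insert k K)
  define s where "s = (\<Sum>i\<in>K. a i)"
  obtain f where f: "\<And>j. j < s \<Longrightarrow> f j \<in> K" "\<And>i. i \<in> K \<Longrightarrow> card {j\<in>{..<s}. f j = i} = a i"
    using insert.IH[of s] s_def by auto
  define g where "g j = (if j < s then f j else k)" for j
  have t: "t = s + a k" using insert by (simp add: s_def)
  have "g j = k \<longleftrightarrow> s \<le> j" for j using f(1)[of j] insert.hyps(2) by (auto simp: g_def)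
  then have "{j\<in>{..<t}. g j = k} = {j\<in>{..<t}. s \<le> j}" by (simp only:)
  also have "\<dots> = {s..<t}" by auto
  finally have "{j\<in>{..<t}. g j = k} = {s..<t}" .
  moreover have "{j\<in>{..<t}. g j = i} = {j\<in>{..<s}. f j = i}" if "i \<in> K" for i
    using that insert.hyps(2) t by (auto simp: g_def)
  ultimately have "\<forall>i\<in>insert k K. card {j\<in>{..<t}. g j = i} = a i" using f(2) t by simp
  moreover have "\<forall>j<t. g j \<in> insert k K" using f(1) by (auto simp: g_def)
  ultimately show ?case by blast
qed auto

lemma vdegree_card_eq:
  assumes "finite V" "v \<in> V" "h > 0"
  shows "vdegree V (\<lambda>S. if card S = h then lam else 0) v = lam * ((card V - 1) choose (h - 1))"
proof -
  have "vdegree V (\<lambda>S. if card S = h then lam else 0) v =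
      (\<Sum>s\<le>h - 1. ((card V - 1) choose s) * (if Suc s = h then lam else 0))"
    using assms(3) by (intro vdegree_card[OF assms(1,2), where g = "\<lambda>s. if s = h then lam else 0"]) auto
  also have "\<dots> = (\<Sum>s\<in>{h - 1}. ((card V - 1) choose s) * (if Suc s = h then lam else 0))"
    using assms(3) by (intro sum.mono_neutral_right) auto
  finally show ?thesis using assms(3) by simp
qed

text \<open>At a vertex of an \<open>r\<close>-regular component \<open>D\<close> the edges inside
  \<open>W\<close> already exhaust the degree \<open>r\<close>. No edge of the extended class
  therefore leaves \<open>D\<close>, and a vertex outside \<open>W\<close> cannot be reached from
  \<open>D\<close>.\<close>

lemma no_regular_component:
  assumes "finite V" "W \<subset> V" "D \<in> W // linked (color_class (complete_hypergraph lam h W) c i)"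
    and agree: "\<And>e. e \<in> edges (complete_hypergraph lam h W) \<Longrightarrow> c' e = c e"
    and reg: "regular r (color_class (complete_hypergraph lam h V) c' i)"
    and conn: "connected_hypergraph (color_class (complete_hypergraph lam h V) c' i)"
  shows "\<not> regular r (induced_hypergraph (color_class (complete_hypergraph lam h W) c i) D)"
proof
  define F where "F = color_class (complete_hypergraph lam h W) c i"
  define F' where "F' = color_class (complete_hypergraph lam h V) c' i"
  assume regD: "regular r (induced_hypergraph (color_class (complete_hypergraph lam h W) c i) D)"
  have vF: "verts F = W" "verts F' = V"
    by (simp_all add: F_def F'_def color_class_def complete_hypergraph_def)
  have D: "D \<in> verts F // linked F" using assms(3) by (simp add: F_def vF[unfolded F_def])
  have eF: "fst e \<subseteq> verts F" if "e \<in> edges F" for e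
    using that by (auto simp: F_def color_class_def complete_hypergraph_def)
  have sub: "edges F \<subseteq> edges F'"
    using agree assms(2) by (auto simp: F_def F'_def color_class_def complete_hypergraph_def)
  have finF': "finite (edges F')"
    by (rule finite_subset[of _ "Pow V \<times> {..<lam}"])
      (use assms(1) in \<open>auto simp: F'_def color_class_def complete_hypergraph_def\<close>)
  have "D \<subseteq> W" using D vF equiv_linked[of F] by (metis Union_quotient Union_upper)
  have closed: "fst e \<subseteq> D" if e: "e \<in> edges F'" "v \<in> D" "v \<in> fst e" for e v
  proof -
    have "degree F v = r"
      using regD degree_component[OF D eF that(2)] that(2)
      by (simp add: regular_def F_def[symmetric]) (simp add: induced_hypergraph_def)
    moreover have "degree F' v = r"
      using reg \<open>D \<subseteq> W\<close> assms(2) that(2) vF by (auto simp: regular_def F'_def)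
    \<comment> \<open>One finite edge set contains the other and both have \<open>r\<close>
      elements.\<close>
    ultimately have "{e\<in>edges F. v \<in> fst e} = {e\<in>edges F'. v \<in> fst e}"
      using sub finF' by (intro card_subset_eq) (auto simp: degree_def)
    then have "e \<in> edges F" using that by auto
    then show ?thesis using edge_in_component[OF D _ eF] that by blast
  qed
  obtain w where w: "w \<in> V" "w \<notin> W" using assms(2) by auto
  obtain u where u: "u \<in> D" using D equiv_linked[of F] in_quotient_imp_non_empty by blast
  have "(u, w) \<in> linked F'"
    using conn u w \<open>D \<subseteq> W\<close> assms(2) vF by (auto simp: connected_hypergraph_def F'_def)
  then have "(u, w) \<in> {(x, y). \<exists>e \<in> edges F'. x \<in> fst e \<and> y \<in> fst e}\<^sup>*" by (simp add: linked_def)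
  then have "w \<in> D"
  proof (induction rule: rtrancl_induct)
    case (step y z)
    then show ?case using closed by blast
  qed (rule u)
  then show False using w \<open>D \<subseteq> W\<close> by blast
qed

section \<open>Assembling the two directions\<close>

theorem theorem7p11:
  fixes n m r lam :: nat
    and V W :: "'a set"
    and G H :: "'a mhypergraph"
    and c :: "'a set \<times> nat \<Rightarrow> nat"
  assumes "n > 0" and "r > 0" and "lam > 0"
    and "m > 5"
    and "real n \<ge> 6.285214 * real m"
    and "finite V" and "card V = n"
    and "W \<subseteq> V" and "card W = m"
    and "G = complete_hypergraph lam 5 V"
    and "H = induced_hypergraph G W"
    and "partial_factorization r (colors 5 n r lam) H c"
  shows "(\<exists>c'. connected_factorization r (colors 5 n r lam) G c' \<and>
               (\<forall>e \<in> edges H. c' e = c e)) \<longleftrightarrow>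
         (admissible 5 n r lam \<and>
          (\<forall>i \<in> colors 5 n r lam. \<forall>C \<in> components (color_class H c i). \<not> regular r C))"
proof
  define K where "K = colors 5 n r lam"
  have finK: "finite K" by (simp add: K_def colors_def)
  have finW: "finite W" using assms finite_subset by blast
  have H: "H = complete_hypergraph lam 5 W" using assms by (simp add: induced_complete_hypergraph)
  have "real (6 * m) \<le> real n" using assms(4,5) by simp
  then have n6: "6 * m \<le> n" by (simp only: of_nat_le_iff)
  then have "W \<noteq> V" using assms by auto
  then have WV: "W \<subset> V" using assms by auto
  have cardK: "card K = (lam * ((n - 1) choose 4)) div r" by (simp add: K_def colors_def)
  {
    assume "\<exists>c'. connected_factorization r (colors 5 n r lam) G c' \<and> (\<forall>e \<in> edges H. c' e = c e)"
    then obtain c' where c': "edge_coloring G K c'" "\<And>e. e \<in> edges H \<Longrightarrow> c' e = c e"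
      "\<And>i. i \<in> K \<Longrightarrow> regular r (color_class G c' i)"
      "\<And>i. i \<in> K \<Longrightarrow> connected_hypergraph (color_class G c' i)"
      by (auto simp: connected_factorization_def is_factor_def K_def)
    define M where "M = edge_mult lam 5 V c'"
    have deg: "vdegree V (M i) v = r" if "i \<in> K" "v \<in> V" for i v
      using c'(3)[OF that(1)] that(2) degree_color_class[OF assms(6), of lam 5 c' i v]
      by (simp add: regular_def M_def assms(10)) (simp add: color_class_def complete_hypergraph_def)
    \<comment> \<open>Any edge shows that some colour exists; the degree sum of its class is
      \<open>r * n\<close> and five times its number of edges.\<close>
    obtain S where S: "S \<subseteq> V" "card S = 5"
      using assms n6 by (metis obtain_subset_with_card_n less_imp_le le_trans card_mono)
    then have "(S, 0) \<in> edges G" using assms by (simp add: complete_hypergraph_def)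
    then have i0: "c' (S, 0) \<in> K" using c'(1) by (simp add: edge_coloring_def)
    have "r * n = (\<Sum>v\<in>V. vdegree V (M (c' (S, 0))) v)" using deg[OF i0] assms by simp
    also have "\<dots> = (\<Sum>T\<in>Pow V. card T * M (c' (S, 0)) T)" by (rule sum_vdegree[OF assms(6)])
    finally have "5 dvd r * n" by (auto simp: M_def edge_mult_def intro: dvd_sum)
    moreover have "r dvd lam * ((n - 1) choose (5 - 1))"
    proof -
      obtain v where v: "v \<in> V" using assms by fastforce
      \<comment> \<open>The degree of one vertex, summed over all classes, is its degree in the
        complete hypergraph.\<close>
      have "r * card K = (\<Sum>i\<in>K. vdegree V (M i) v)" using deg v by simp
      also have "\<dots> = vdegree V (\<lambda>S. if card S = 5 then lam else 0) v"
        unfolding vdegree_sum unfolding vdegree_def M_def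
        using sum_edge_mult[OF finK c'(1)[unfolded assms(10)]] by (intro sum.cong) simp_all
      also have "\<dots> = lam * ((n - 1) choose (5 - 1))"
        using vdegree_card_eq[OF assms(6) v, of 5] assms(7) by simp
      finally show ?thesis by (metis dvd_triv_left)
    qed
    moreover have "\<not> regular r C" if i: "i \<in> K" and C: "C \<in> components (color_class H c i)" for i C
    proof -
      obtain D where "D \<in> W // linked (color_class H c i)" "C = induced_hypergraph (color_class H c i) D"
        using C by (auto simp: components_def color_class_def H complete_hypergraph_def)
      then show ?thesis
        using no_regular_component[OF assms(6) WV, of D lam 5 c i c' r] c' i assms(10) H by simp
    qed
    ultimately show "admissible 5 n r lam \<and>
          (\<forall>i \<in> colors 5 n r lam. \<forall>C \<in> components (color_class H c i). \<not> regular r C)"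
      by (simp add: admissible_def K_def)
  next
    assume adm: "admissible 5 n r lam \<and>
          (\<forall>i \<in> colors 5 n r lam. \<forall>C \<in> components (color_class H c i). \<not> regular r C)"
    define M0 where "M0 = edge_mult lam 5 W c"
    have pf: "edge_coloring H K c" "\<And>i v. i \<in> K \<Longrightarrow> v \<in> W \<Longrightarrow> vdegree W (M0 i) v \<le> r"
      using assms(12) degree_color_class[OF finW, of lam 5 c]
      by (auto simp: partial_factorization_def K_def H M0_def) (simp add: complete_hypergraph_def)
    have "\<exists>M. stage 5 r n lam K W M \<and> (\<forall>i\<in>K. \<forall>S. S \<subseteq> W \<longrightarrow> card S = 5 \<longrightarrow> M i S = M0 i S)"
    proof (rule initial_stage[OF finK finW])
      show "card W > 5" "6 * card W \<le> n" "r > 0" "lam > 0" using assms n6 by auto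
      show "((n - 1) choose 4) \<le> 2 * ((n - card W) choose 4)"
        using binomial_4_ratio[of m n] assms by simp
      show "5 dvd r * n" using adm by (simp add: admissible_def)
      show "r * card K = lam * ((n - 1) choose 4)"
        unfolding cardK using adm by (intro dvd_mult_div_cancel) (simp add: admissible_def)
      show "(\<Sum>i\<in>K. M0 i S) = (if card S = 5 then lam else 0)" if "S \<in> Pow W" for S
        unfolding M0_def using pf(1) that by (intro sum_edge_mult[OF finK]) (simp_all add: H)
      show "M0 i S = 0" if "i \<in> K" "S \<notin> Pow W" for i S using that by (auto simp: M0_def edge_mult_def)
      show "vdegree W (M0 i) v \<le> r" if "i \<in> K" "v \<in> W" for i v using pf(2)[OF that] .
      show "\<exists>v\<in>C. vdegree W (M0 i) v \<noteq> r" if i: "i \<in> K" and C: "C \<in> W // class_rel (M0 i) W" for i C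
      proof (rule ccontr)
        define F where "F = color_class H c i"
        assume "\<not> ?thesis"
        then have degC: "degree F v = r" if "v \<in> C" for v
          using that degree_color_class[OF finW, of lam 5 c i v] by (simp add: F_def H M0_def)
        have vF: "verts F = W" by (simp add: F_def H color_class_def complete_hypergraph_def)
        have CF: "C \<in> verts F // linked F"
          using C unfolding vF by (simp add: F_def H linked_color_class M0_def)
        have "fst e \<subseteq> verts F" if "e \<in> edges F" for e
          using that by (auto simp: F_def H color_class_def complete_hypergraph_def)
        then have "regular r (induced_hypergraph F C)"
          using degree_component[OF CF] degC
          by (simp add: regular_def) (simp add: induced_hypergraph_def)
        moreover have "induced_hypergraph F C \<in> components F" using CF by (simp add: components_def)
        ultimately show False using adm i by (auto simp: F_def K_def)
      qed
    qed
    then obtain M where M: "stage 5 r n lam K W M"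
      "\<And>i S. i \<in> K \<Longrightarrow> S \<subseteq> W \<Longrightarrow> card S = 5 \<Longrightarrow> M i S = M0 i S" by blast
    obtain M' where M': "stage 5 r n lam K V M'"
      "\<And>i S. i \<in> K \<Longrightarrow> S \<subseteq> W \<Longrightarrow> card S = 5 \<Longrightarrow> M' i S = M i S"
      using detachment[OF finK assms(6,7,8) M(1)] by blast
    have "\<exists>f. (\<forall>j<lam. f j \<in> K) \<and> (\<forall>i\<in>K. card {j\<in>{..<lam}. f j = i} = M' i S)"
      if "S \<subseteq> V" "card S = 5" for S
      using M'(1) that assms(7) by (intro exists_function_with_fibres[OF finK]) (simp add: stage_def)
    then obtain f where f: "\<And>S j. S \<subseteq> V \<Longrightarrow> card S = 5 \<Longrightarrow> j < lam \<Longrightarrow> f S j \<in> K"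
      "\<And>S i. S \<subseteq> V \<Longrightarrow> card S = 5 \<Longrightarrow> i \<in> K \<Longrightarrow> card {j\<in>{..<lam}. f S j = i} = M' i S"
      by metis
    \<comment> \<open>\<open>M'\<close> only prescribes how many copies of a set get each colour.
      Inside \<open>W\<close> the labels keep the colours of \<open>c\<close>, whose counts agree
      with \<open>M'\<close>; elsewhere the labels are dealt out freely.\<close>
    define c' where "c' e = (if fst e \<subseteq> W then c e else f (fst e) (snd e))" for e
    have agree: "\<forall>e \<in> edges H. c' e = c e" by (auto simp: c'_def H complete_hypergraph_def)
    have col: "edge_coloring G K c'"
      using pf(1) f(1) by (auto simp: edge_coloring_def c'_def assms(10) H complete_hypergraph_def)
    have fac: "is_factor r (color_class G c' i) G \<and> connected_hypergraph (color_class G c' i)"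
      if i: "i \<in> K" for i
    proof -
      obtain P where P: "class_state 5 r n V (M' i) P" using M'(1) i by (auto simp: stage_def)
      interpret class_state 5 r n V "M' i" P by (rule P)
      have ne5: "M' i S = 0" if "S \<subseteq> V" "card S \<noteq> 5" for S
      proof -
        \<comment> \<open>At the last stage no merged vertex is left, so there are no hinges and
          only full edges of five vertices occur.\<close>
        have "(5 - card S) * M' i S = 0"
          using total assms(6,7) that by simp
        then show ?thesis using support[of S] that by (cases "M' i S") auto
      qed
      have Meq: "edge_mult lam 5 V c' i S = M' i S" if "S \<in> Pow V" for S
      proof (cases "card S = 5")
        case True
        show ?thesis
        proof (cases "S \<subseteq> W")
          case W: True
          then have "edge_mult lam 5 V c' i S = M0 i S"
            using True that by (simp add: edge_mult_def c'_def M0_def)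
          then show ?thesis using M'(2)[OF i W True] M(2)[OF i W True] by simp
        next
          case False
          then show ?thesis using f(2)[OF _ True i] True that by (simp add: edge_mult_def c'_def)
        qed
      qed (use ne5 that in \<open>simp add: edge_mult_def\<close>)
      have "vdegree V (edge_mult lam 5 V c' i) v = r" if "v \<in> V" for v
        unfolding deg[OF that, symmetric] vdegree_def by (intro sum.cong) (simp_all add: Meq)
      then have "is_factor r (color_class G c' i) G"
        using degree_color_class[OF assms(6), of lam 5 c' i]
        by (simp add: is_factor_def regular_def spanning_subhypergraph_def assms(10))
          (auto simp: color_class_def complete_hypergraph_def)
      moreover have "(x, y) \<in> linked (color_class G c' i)" if "x \<in> V" "y \<in> V" for x y
      proof -
        \<comment> \<open>With all \<open>n\<close> vertices split off, the tree bound
          \<open>(r - 1) * 0 + 1\<close> allows a single part, which is connected.\<close>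
        have "card P \<le> Suc 0" using few_parts assms(7) by simp
        moreover have "x \<in> \<Union>P" "y \<in> \<Union>P" using part that by (simp_all add: partition_on_def)
        then obtain C D where CD: "C \<in> P" "x \<in> C" "D \<in> P" "y \<in> D" by blast
        ultimately have "C = D" using finP by (meson card_le_Suc0_iff_eq)
        then have "(x, y) \<in> (class_link (M' i))\<^sup>*" using conn CD by blast
        moreover have "class_link (M' i) \<subseteq> class_link (edge_mult lam 5 V c' i)"
        proof -
          have "edge_mult lam 5 V c' i S > 0" if "M' i S > 0" for S
            using Meq[of S] support[OF that] that by simp
          then show ?thesis by (auto simp: class_link_def)
        qed
        then have "(class_link (M' i))\<^sup>* \<subseteq> (class_link (edge_mult lam 5 V c' i))\<^sup>*"
          by (rule rtrancl_mono)
        ultimately show ?thesis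
          using that unfolding assms(10) linked_color_class class_rel_def by blast
      qed
      ultimately show ?thesis
        by (simp add: connected_hypergraph_def color_class_def assms(10) complete_hypergraph_def)
    qed
    show "\<exists>c'. connected_factorization r (colors 5 n r lam) G c' \<and> (\<forall>e \<in> edges H. c' e = c e)"
      using col fac agree by (intro exI[of _ c']) (simp add: connected_factorization_def K_def)
  }
qed

end
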